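(* Let $Q$ be an ergodic generator, partitioned into levels $L_0,L_1,\dots$ with blocks $Q_{k,\ell}$, with stationary distribution vector $\pi=(\pi_0,\pi_1,\dots)$, and suppose that $Q$ is in upper block-Hessenberg form, i.e. $Q_{k,\ell}=O$ whenever $\ell\le k-2$. For $N\in\{1,2,\dots\}$ and $s\in\{N+1,N+2,\dots\}$, let $\eta_s^{(N)}=(\eta_{s,0}^{(N)},\dots,\eta_{s,N}^{(N)})$ denote the probability vector with $$\eta_{s,k}^{(N)}=\frac{e^\top U_s^*U_{s,k}}{e^\top\sum_{\ell=0}^NU_s^*U_{s,\ell}e},\qquad k\in\{0,1,\dots,N\},$$ and let $\pi^{(N)}=(\pi_0^{(N)},\dots,\pi_N^{(N)})$ denote the probability vector with $$\pi_k^{(N)}=\frac{\pi_k}{\sum_{\ell=0}^N\pi_\ell e},\qquad k\in\{0,1,\dots,N\}.$$ Then, for every $N\in\{1,2,\dots\}$, $$\lim_{s\to\infty}\|\eta_s^{(N)}-\pi^{(N)}\|=0,$$ and thus $$\pi_k=\lim_{N\to\infty}\lim_{s\to\infty}\frac{e^\top U_s^*U_{s,k}}{e^\top\sum_{\ell=0}^NU_s^*U_{s,\ell}e},\qquad k\in\mathbb{Z}_+ .$$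
   Context: $\mathbb{Z}_+=\{0,1,2,\dots\}$. An ergodic generator is the infinitesimal generator ($Q$-matrix) $Q=(q(i,j))_{i,j\in\mathbb{Z}_+}$ of an ergodic (irreducible and positive recurrent, hence non-explosive) continuous-time Markov chain on $\mathbb{Z}_+$; thus $\sum_{j}q(i,j)=0$, $q(i,i)\in(-\infty,0)$ and $q(i,j)\ge 0$ for $j\ne i$. Its stationary distribution vector $\pi$ is the unique positive row vector with $\pi Q=0$ and $\pi e=1$, where $e$ is a column vector of ones of appropriate order. For a row vector $x=(x(j))$, $\|x\|=\sum_j|x(j)|$. Levels: let $m_0,m_1,\dots$ be positive integers, $n_{-1}=-1$, $n_s=\sum_{\ell=0}^sm_\ell-1$, and $L_s=\{n_{s-1}+1,\dots,n_s\}$ (level $s$, of cardinality $m_s$). Then $Q_{k,\ell}=(q(i,j))_{i\in L_k,j\in L_\ell}$ and $\pi_k=(\pi(i))_{i\in L_k}$. For upper block-Hessenberg $Q$, define recursively $$U_0^*=(-Q_{0,0})^{-1},\qquad U_k^*=\Big(-Q_{k,k}-\sum_{\ell=0}^{k-1}U_{k,\ell}Q_{\ell,k}\Big)^{-1},\quad k\ge1,$$ where $U_{k,\ell}=(Q_{k,k-1}U_{k-1}^* )(Q_{k-1,k-2}U_{k-2}^* )\cdots(Q_{\ell+1,\ell}U_\ell^* )$ for $0\le\ell\le k-1$, and $U_{k,k}=I$. (The inverses exist.) *)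

theory Defs
  imports "HOL-Probability.Probability" "Jordan_Normal_Form.Gauss_Jordan_Elimination"
begin

text \<open>Stable, conservative \<open>Q\<close>-matrices on the state space \<open>nat\<close>.\<close>

definition q_matrix :: "(nat \<Rightarrow> nat \<Rightarrow> real) \<Rightarrow> bool" where
  "q_matrix Q \<longleftrightarrow>
     (\<forall>i. Q i i < 0) \<and> (\<forall>i j. i \<noteq> j \<longrightarrow> 0 \<le> Q i j) \<and> (\<forall>i. (\<lambda>j. Q i j) sums 0)"

definition jump_prob :: "(nat \<Rightarrow> nat \<Rightarrow> real) \<Rightarrow> nat \<Rightarrow> nat \<Rightarrow> real" where
  "jump_prob Q i j = (if i = j then 0 else Q i j / (- Q i i))"

text \<open>
  A continuous-time Markov chain with generator \<open>Q\<close> is given by its jump chain \<open>Y\<close> and its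
  holding times \<open>S\<close>, under a family of probability measures \<open>P i\<close>, where \<open>i\<close> is the initial
  state: \<open>Y\<close> is a discrete-time Markov chain with transition matrix \<open>jump_prob Q\<close> and, given
  \<open>Y\<close>, the holding times are independent, \<open>S k\<close> being exponential with rate \<open>- Q (Y k) (Y k)\<close>.
  This is expressed through the joint law of \<open>Y 0, \<dots>, Y n, S 0, \<dots>, S n\<close>.
\<close>

definition markov_chain_with_generator ::
  "(nat \<Rightarrow> nat \<Rightarrow> real) \<Rightarrow> (nat \<Rightarrow> 'w measure) \<Rightarrow> (nat \<Rightarrow> 'w \<Rightarrow> nat) \<Rightarrow> (nat \<Rightarrow> 'w \<Rightarrow> real) \<Rightarrow> bool"
where
  "markov_chain_with_generator Q P Y S \<longleftrightarrow>
     q_matrix Q \<and>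
     (\<forall>i. prob_space (P i)) \<and>
     (\<forall>i n. Y n \<in> measurable (P i) (count_space UNIV)) \<and>
     (\<forall>i n. S n \<in> borel_measurable (P i)) \<and>
     (\<forall>i n (x :: nat \<Rightarrow> nat) (t :: nat \<Rightarrow> real). (\<forall>k\<le>n. 0 \<le> t k) \<longrightarrow>
        measure (P i) {\<omega> \<in> space (P i). \<forall>k\<le>n. Y k \<omega> = x k \<and> t k < S k \<omega>} =
          (if x 0 = i
           then (\<Prod>k<n. jump_prob Q (x k) (x (Suc k))) * (\<Prod>k\<le>n. exp (Q (x k) (x k) * t k))
           else 0))"

definition jump_time :: "(nat \<Rightarrow> 'w \<Rightarrow> real) \<Rightarrow> nat \<Rightarrow> 'w \<Rightarrow> real" where
  "jump_time S n \<omega> = (\<Sum>k<n. S k \<omega>)"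

text \<open>
  The chain sits in \<open>Y n \<omega>\<close> on the interval from \<open>jump_time S n \<omega>\<close> to \<open>jump_time S (Suc n) \<omega>\<close>;
  \<open>occupation_times Y S i \<omega>\<close> are the times (before a possible explosion) spent in state \<open>i\<close>.
  The return time is \<open>\<infinity>\<close> if the chain never comes back.
\<close>

definition occupation_times ::
  "(nat \<Rightarrow> 'w \<Rightarrow> nat) \<Rightarrow> (nat \<Rightarrow> 'w \<Rightarrow> real) \<Rightarrow> nat \<Rightarrow> 'w \<Rightarrow> real set" where
  "occupation_times Y S i \<omega> =
     {t. \<exists>n. jump_time S n \<omega> \<le> t \<and> t < jump_time S (Suc n) \<omega> \<and> Y n \<omega> = i}"

definition return_time ::
  "(nat \<Rightarrow> 'w \<Rightarrow> nat) \<Rightarrow> (nat \<Rightarrow> 'w \<Rightarrow> real) \<Rightarrow> nat \<Rightarrow> 'w \<Rightarrow> ennreal" where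
  "return_time Y S i \<omega> = (INF t \<in> occupation_times Y S i \<omega> \<inter> {jump_time S 1 \<omega>..}. ennreal t)"

definition irreducible_q_matrix :: "(nat \<Rightarrow> nat \<Rightarrow> real) \<Rightarrow> bool" where
  "irreducible_q_matrix Q \<longleftrightarrow> (\<forall>i j. (i, j) \<in> {(a, b). a \<noteq> b \<and> 0 < Q a b}\<^sup>*)"

definition positive_recurrent ::
  "(nat \<Rightarrow> 'w measure) \<Rightarrow> (nat \<Rightarrow> 'w \<Rightarrow> nat) \<Rightarrow> (nat \<Rightarrow> 'w \<Rightarrow> real) \<Rightarrow> bool" where
  "positive_recurrent P Y S \<longleftrightarrow> (\<forall>i. (\<integral>\<^sup>+ \<omega>. return_time Y S i \<omega> \<partial>P i) < \<infinity>)"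

definition generator_of_ergodic_chain ::
  "(nat \<Rightarrow> nat \<Rightarrow> real) \<Rightarrow> (nat \<Rightarrow> 'w measure) \<Rightarrow> (nat \<Rightarrow> 'w \<Rightarrow> nat) \<Rightarrow> (nat \<Rightarrow> 'w \<Rightarrow> real) \<Rightarrow> bool"
where
  "generator_of_ergodic_chain Q P Y S \<longleftrightarrow>
     markov_chain_with_generator Q P Y S \<and> irreducible_q_matrix Q \<and> positive_recurrent P Y S"

definition stationary_distribution :: "(nat \<Rightarrow> nat \<Rightarrow> real) \<Rightarrow> (nat \<Rightarrow> real) \<Rightarrow> bool" where
  "stationary_distribution Q \<pi> \<longleftrightarrow>
     (\<forall>i. 0 < \<pi> i) \<and> (\<forall>j. (\<lambda>i. \<pi> i * Q i j) sums 0) \<and> \<pi> sums 1"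

text \<open>
  \<open>level_start m s\<close> is \<open>n\<^bsub>s-1\<^esub> + 1\<close>, so level \<open>s\<close> consists of the \<open>m s\<close> states
  \<open>level_start m s, \<dots>, level_start m (Suc s) - 1\<close>.  Row and column vectors are matrices with
  one row and one column, respectively.
\<close>

definition level_start :: "(nat \<Rightarrow> nat) \<Rightarrow> nat \<Rightarrow> nat" where
  "level_start m s = (\<Sum>l<s. m l)"

definition Q_block :: "(nat \<Rightarrow> nat \<Rightarrow> real) \<Rightarrow> (nat \<Rightarrow> nat) \<Rightarrow> nat \<Rightarrow> nat \<Rightarrow> real mat" where
  "Q_block Q m k l =
     mat (m k) (m l) (\<lambda>(a, b). Q (level_start m k + a) (level_start m l + b))"

definition pi_block :: "(nat \<Rightarrow> real) \<Rightarrow> (nat \<Rightarrow> nat) \<Rightarrow> nat \<Rightarrow> real mat" where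
  "pi_block \<pi> m k = mat 1 (m k) (\<lambda>(a, b). \<pi> (level_start m k + b))"

definition upper_block_hessenberg :: "(nat \<Rightarrow> nat \<Rightarrow> real) \<Rightarrow> (nat \<Rightarrow> nat) \<Rightarrow> bool" where
  "upper_block_hessenberg Q m \<longleftrightarrow> (\<forall>k l. l + 2 \<le> k \<longrightarrow> Q_block Q m k l = 0\<^sub>m (m k) (m l))"

definition ones_row :: "nat \<Rightarrow> real mat" where
  "ones_row n = mat 1 n (\<lambda>_. 1)"

definition ones_col :: "nat \<Rightarrow> real mat" where
  "ones_col n = mat n 1 (\<lambda>_. 1)"

definition row_norm :: "real mat \<Rightarrow> real" where
  "row_norm x = (\<Sum>j<dim_col x. \<bar>x $$ (0, j)\<bar>)"

text \<open>Finite sums of matrices of a given size (there is no zero shared by all sizes).\<close>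

definition mat_sum :: "nat \<Rightarrow> nat \<Rightarrow> (nat \<Rightarrow> real mat) \<Rightarrow> nat set \<Rightarrow> real mat" where
  "mat_sum nr nc f A = mat nr nc (\<lambda>ij. \<Sum>l\<in>A. f l $$ ij)"

text \<open>Only used for invertible matrices.\<close>

definition mat_inv :: "real mat \<Rightarrow> real mat" where
  "mat_inv A = the (mat_inverse A)"

text \<open>
  \<open>U_star Q m k\<close> is \<open>U\<^sub>k\<^sup>*\<close> and \<open>U_prod Q m k l\<close> is \<open>U\<^bsub>k,l\<^esub>\<close>, where the product defining the
  latter is unrolled from its leftmost factor.  The value of \<open>U_prod Q m k l\<close> for \<open>l > k\<close> is
  arbitrary.
\<close>

function U_star :: "(nat \<Rightarrow> nat \<Rightarrow> real) \<Rightarrow> (nat \<Rightarrow> nat) \<Rightarrow> nat \<Rightarrow> real mat"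
  and U_prod :: "(nat \<Rightarrow> nat \<Rightarrow> real) \<Rightarrow> (nat \<Rightarrow> nat) \<Rightarrow> nat \<Rightarrow> nat \<Rightarrow> real mat"
where
  "U_star Q m 0 = mat_inv (- Q_block Q m 0 0)"
| "U_star Q m (Suc k) =
     mat_inv (- Q_block Q m (Suc k) (Suc k)
       - mat_sum (m (Suc k)) (m (Suc k)) (\<lambda>l. U_prod Q m (Suc k) l * Q_block Q m l (Suc k)) {..k})"
| "U_prod Q m 0 l = 1\<^sub>m (m 0)"
| "U_prod Q m (Suc k) l =
     (if l \<le> k then (Q_block Q m (Suc k) k * U_star Q m k) * U_prod Q m k l
      else 1\<^sub>m (m (Suc k)))"
  by pat_completeness auto
termination
  by (relation "Wellfounded.measure (\<lambda>x. case x of Inl (Q, m, k) \<Rightarrow> 2 * k + 1 | Inr (Q, m, k, l) \<Rightarrow> 2 * k)") auto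

text \<open>
  The \<open>k\<close>-th blocks of \<open>\<eta>\<^sub>s\<close> and \<open>\<pi>\<close> for truncation level \<open>N\<close>.  The one-by-one matrices in
  the denominators are read as scalars.
\<close>

definition eta_block ::
  "(nat \<Rightarrow> nat \<Rightarrow> real) \<Rightarrow> (nat \<Rightarrow> nat) \<Rightarrow> nat \<Rightarrow> nat \<Rightarrow> nat \<Rightarrow> real mat" where
  "eta_block Q m N s k =
     (1 / (ones_row (m s) *
           mat_sum (m s) 1 (\<lambda>l. U_star Q m s * U_prod Q m s l * ones_col (m l)) {..N}) $$ (0, 0))
     \<cdot>\<^sub>m (ones_row (m s) * (U_star Q m s * U_prod Q m s k))"

definition pi_trunc_block :: "(nat \<Rightarrow> real) \<Rightarrow> (nat \<Rightarrow> nat) \<Rightarrow> nat \<Rightarrow> nat \<Rightarrow> real mat" where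
  "pi_trunc_block \<pi> m N k =
     (1 / (\<Sum>l\<le>N. (pi_block \<pi> m l * ones_col (m l)) $$ (0, 0))) \<cdot>\<^sub>m pi_block \<pi> m k"

text \<open>The 1-norm of a row vector \<open>(x 0, \<dots>, x N)\<close> given by its blocks.\<close>

definition block_row_norm :: "nat \<Rightarrow> (nat \<Rightarrow> real mat) \<Rightarrow> real" where
  "block_row_norm N x = (\<Sum>k\<le>N. row_norm (x k))"

end

theory Submission
  imports Defs "Jordan_Normal_Form.Determinant"
begin

text \<open>
  Up to normalisation, the blocks \<open>e\<^sup>T U\<^sub>s\<^sup>* U\<^bsub>s,k\<^esub>\<close> form the row vector \<open>x\<close> on the levels
  \<open>0, \<dots>, s\<close> with \<open>x A = (0, \<dots>, 0, - e\<^sup>T)\<close>, where \<open>A\<close> is the truncation of \<open>Q\<close> to these levels.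
  Such an \<open>x\<close> is positive by a minimum principle (compare with multiples of \<open>\<pi>\<close>), and by Fatou's
  lemma the pointwise lower limit of \<open>x / x b\<close> as \<open>s \<rightarrow> \<infinity>\<close> is a subinvariant measure.  By recurrence the
  excursion measure from \<open>b\<close> is both minimal among subinvariant measures normalised at \<open>b\<close> and
  proportional to the stationary one, so \<open>liminf x j / x b \<ge> \<pi> j / \<pi> b\<close>.  Exchanging \<open>j\<close> and \<open>b\<close>
  turns this into \<open>lim x j / x b = \<pi> j / \<pi> b\<close>.
\<close>

subsection \<open>A minimum principle for finite truncations\<close>

lemma q_matrix_diag_neg: "q_matrix Q \<Longrightarrow> Q i i < 0"
  and q_matrix_offdiag_nonneg: "q_matrix Q \<Longrightarrow> i \<noteq> j \<Longrightarrow> 0 \<le> Q i j"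
  and q_matrix_row_sums: "q_matrix Q \<Longrightarrow> (\<lambda>j. Q i j) sums 0"
  by (auto simp: q_matrix_def)

text \<open>The form in which irreducibility is used: \<open>M\<close> will be the zero set of a
  nonnegative vector, and a path leading from any state to \<open>b\<close> is traced
  backwards.\<close>

lemma irreducible_predecessor_closed:
  assumes irr: "irreducible_q_matrix Q" and b: "b \<in> M"
    and cl: "\<And>i j. j \<in> M \<Longrightarrow> i \<noteq> j \<Longrightarrow> 0 < Q i j \<Longrightarrow> i \<in> M"
  shows "M = UNIV"
proof -
  have "i \<in> M" for i
  proof -
    have "(i, b) \<in> {(a, b). a \<noteq> b \<and> 0 < Q a b}\<^sup>*"
      using irr by (auto simp: irreducible_q_matrix_def)
    then show ?thesis
      by (induction rule: converse_rtrancl_induct) (auto intro: b cl)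
  qed
  then show ?thesis by auto
qed

text \<open>The only negative term in column \<open>j\<close> of \<open>\<pi> Q = 0\<close> is the
  diagonal one. A set containing \<open>j\<close> keeps that term and drops only nonnegative
  ones.\<close>

lemma stationary_partial_sum_nonpos:
  assumes q: "q_matrix Q" and st: "stationary_distribution Q \<pi>" and B: "finite B" "j \<in> B"
  shows "(\<Sum>i\<in>B. \<pi> i * Q i j) \<le> 0"
proof -
  have s: "(\<lambda>i. \<pi> i * Q i j) sums 0" and p: "\<And>i. 0 < \<pi> i"
    using st by (auto simp: stationary_distribution_def)
  have "(\<Sum>i\<in>B. \<pi> i * Q i j) \<le> suminf (\<lambda>i. \<pi> i * Q i j)"
    using s B
    by (intro sum_le_suminf mult_nonneg_nonneg less_imp_le[OF p] q_matrix_offdiag_nonneg[OF q])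
      (auto simp: sums_iff)
  with s show ?thesis by (simp add: sums_iff)
qed

text \<open>
  Subtract the largest multiple \<open>c \<pi>\<close> lying below \<open>x\<close> on \<open>A\<close>: if \<open>c < 0\<close>, the zero set of the
  difference is a finite nonempty set closed under predecessors.
\<close>

lemma finite_minimum_principle:
  assumes q: "q_matrix Q" and irr: "irreducible_q_matrix Q" and st: "stationary_distribution Q \<pi>"
    and A: "finite A" and sub: "\<And>j. j \<in> A \<Longrightarrow> (\<Sum>i\<in>A. x i * Q i j) \<le> 0" and a: "a \<in> A"
  shows "0 \<le> x a"
proof (rule ccontr)
  assume neg: "\<not> 0 \<le> x a"
  have p: "0 < \<pi> i" for i using st by (auto simp: stationary_distribution_def)
  define c where "c = Min ((\<lambda>i. x i / \<pi> i) ` A)"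
  have c_le: "c \<le> x i / \<pi> i" if "i \<in> A" for i
    using A that by (simp add: c_def)
  have "c \<in> (\<lambda>i. x i / \<pi> i) ` A"
    unfolding c_def using A a by (intro Min_in) auto
  then obtain b where b: "b \<in> A" "c = x b / \<pi> b" by auto
  have "x a / \<pi> a < 0" using neg p[of a] by (simp add: divide_neg_pos)
  with c_le[OF a] have c: "c < 0" by linarith
  \<comment> \<open>Extending \<open>x\<close> by zero makes \<open>w\<close> equal to
    \<open>- c * \<pi> i > 0\<close> off \<open>A\<close>, so every zero of \<open>w\<close> lies in
    \<open>A\<close>.\<close>
  define w where "w i = (if i \<in> A then x i else 0) - c * \<pi> i" for i
  have w_out: "0 < w i" if "i \<notin> A" for i
    using that c p[of i] by (simp add: w_def mult_neg_pos)
  have w_nn: "0 \<le> w i" for i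
  proof (cases "i \<in> A")
    case True
    with c_le[OF True] p[of i] show ?thesis by (simp add: w_def pos_le_divide_eq)
  next
    case False
    with w_out show ?thesis by (simp add: less_imp_le)
  qed
  have "{i. w i = 0} = UNIV"
  proof (rule irreducible_predecessor_closed[OF irr])
    show "b \<in> {i. w i = 0}" using b p[of b] by (simp add: w_def)
  next
    fix i j assume j: "j \<in> {i. w i = 0}" and ij: "i \<noteq> j" "0 < Q i j"
    then have jA: "j \<in> A" using w_out[of j] by force
    \<comment> \<open>The predecessor \<open>i\<close> may lie outside \<open>A\<close>, so its term
      is added; there \<open>x\<close> contributes nothing, and the partial sum bound for
      \<open>\<pi>\<close> still applies.\<close>
    let ?B = "insert i A"
    have "(\<Sum>k\<in>?B. w k * Q k j)
        = (\<Sum>k\<in>?B. (if k \<in> A then x k * Q k j else 0)) - c * (\<Sum>k\<in>?B. \<pi> k * Q k j)"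
      unfolding sum_distrib_left sum_subtractf[symmetric]
      by (rule sum.cong) (auto simp: w_def algebra_simps)
    also have "(\<Sum>k\<in>?B. (if k \<in> A then x k * Q k j else 0)) = (\<Sum>k\<in>A. x k * Q k j)"
      using A by (simp add: sum.If_cases Int_absorb1 subset_insertI)
    also have "\<dots> - c * (\<Sum>k\<in>?B. \<pi> k * Q k j) \<le> 0"
      using sub[OF jA] c stationary_partial_sum_nonpos[OF q st, of ?B j] A jA
      by (simp add: mult_nonpos_nonpos add_nonpos_nonpos diff_le_0_iff_le
          order_trans[OF _ mult_nonpos_nonpos])
    finally have le: "(\<Sum>k\<in>?B. w k * Q k j) \<le> 0" .
    \<comment> \<open>At a zero \<open>j\<close> of \<open>w\<close> the negative diagonal entry is
      multiplied by zero. A nonpositive sum of nonnegative terms then forces each term to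
      vanish.\<close>
    have nn: "0 \<le> w k * Q k j" for k
      using j w_nn q_matrix_offdiag_nonneg[OF q, of k j] by (cases "k = j") auto
    have "w i * Q i j \<le> (\<Sum>k\<in>?B. w k * Q k j)"
      using A by (intro member_le_sum) (auto intro: nn)
    with le nn[of i] have "w i * Q i j = 0" by linarith
    with ij show "i \<in> {i. w i = 0}" by simp
  qed
  then have "A = UNIV" using w_out by force
  with A show False by simp
qed

subsection \<open>Excursion measures\<close>

text \<open>Values in \<open>ennreal\<close> allow infinite sums to be formed and interchanged
  without summability conditions.\<close>

definition jump_ennreal :: "(nat \<Rightarrow> nat \<Rightarrow> real) \<Rightarrow> nat \<Rightarrow> nat \<Rightarrow> ennreal" where
  "jump_ennreal Q i j = ennreal (jump_prob Q i j)"

lemma jump_prob_nonneg: "q_matrix Q \<Longrightarrow> 0 \<le> jump_prob Q i j"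
  using q_matrix_diag_neg[of Q i] q_matrix_offdiag_nonneg[of Q i j]
  by (auto simp: jump_prob_def intro!: divide_nonneg_pos divide_nonneg_neg)

lemma suminf_jump_ennreal:
  assumes q: "q_matrix Q"
  shows "(\<Sum>j. jump_ennreal Q i j) = 1"
proof -
  have "(\<lambda>j. Q i j) sums 0" using q_matrix_row_sums[OF q] .
  then have "(\<lambda>j. Q i j - (if j = i then Q i i else 0)) sums (0 - Q i i)"
    by (intro sums_diff) (use sums_single[of i "\<lambda>_. Q i i"] in auto)
  then have "(\<lambda>j. (Q i j - (if j = i then Q i i else 0)) / (- Q i i)) sums ((0 - Q i i) / (- Q i i))"
    by (rule sums_divide)
  also have "(\<lambda>j. (Q i j - (if j = i then Q i i else 0)) / (- Q i i)) = jump_prob Q i"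
    by (auto simp: jump_prob_def)
  also have "(0 - Q i i) / (- Q i i) = 1" using q_matrix_diag_neg[OF q, of i] by simp
  finally have "jump_prob Q i sums 1" .
  then show ?thesis
    using suminf_ennreal_eq[OF jump_prob_nonneg[OF q]] by (force simp: jump_ennreal_def)
qed

text \<open>Tonelli's theorem for the counting measure.\<close>

lemma ennreal_suminf_swap:
  fixes f :: "nat \<Rightarrow> nat \<Rightarrow> ennreal"
  shows "(\<Sum>i. \<Sum>j. f i j) = (\<Sum>j. \<Sum>i. f i j)"
  using nn_integral_suminf[of "\<lambda>j i. f i j" "count_space UNIV"]
  by (simp add: nn_integral_count_space_nat)

lemma suminf_add_ennreal:
  fixes f g :: "nat \<Rightarrow> ennreal"
  shows "(\<Sum>i. f i + g i) = (\<Sum>i. f i) + (\<Sum>i. g i)"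
  by (rule suminf_add[symmetric]) auto

lemma suminf_split_off:
  fixes f :: "nat \<Rightarrow> ennreal"
  shows "(\<Sum>i. f i) = f b + (\<Sum>i. if i = b then 0 else f i)"
proof -
  have "(\<Sum>i. f i) = (\<Sum>i. (if i = b then f b else 0) + (if i = b then 0 else f i))"
    by (rule arg_cong[where f = suminf]) auto
  also have "\<dots> = (\<Sum>i. if i = b then f b else 0) + (\<Sum>i. if i = b then 0 else f i)"
    by (rule suminf_add_ennreal)
  also have "(\<Sum>i. if i = b then f b else 0) = f b"
    using sums_single[of b "\<lambda>_. f b"] by (simp add: sums_iff)
  finally show ?thesis .
qed

text \<open>
  \<open>taboo Q b n j\<close> is the probability that the jump chain started in \<open>b\<close> is in \<open>j\<close> at time \<open>n + 1\<close>
  and avoids \<open>b\<close> at the times \<open>1, \<dots>, n\<close>.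
\<close>

primrec taboo :: "(nat \<Rightarrow> nat \<Rightarrow> real) \<Rightarrow> nat \<Rightarrow> nat \<Rightarrow> nat \<Rightarrow> ennreal" where
  "taboo Q b 0 j = jump_ennreal Q b j"
| "taboo Q b (Suc n) j = (\<Sum>i. (if i = b then 0 else taboo Q b n i) * jump_ennreal Q i j)"

text \<open>Conservation of mass: what arrives at \<open>b\<close> is removed as a first return, and
  the rest is moved on by a stochastic matrix. The first sum is the probability of a return by time
  \<open>n\<close>, the second that of avoiding \<open>b\<close> at the times 1 to
  \<open>n\<close>.\<close>

lemma taboo_mass:
  assumes q: "q_matrix Q"
  shows "(\<Sum>k<n. taboo Q b k b) + (\<Sum>j. taboo Q b n j) = 1"
proof (induction n)
  case 0
  then show ?case using suminf_jump_ennreal[OF q] by simp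
next
  case (Suc n)
  have "(\<Sum>j. taboo Q b (Suc n) j)
      = (\<Sum>i. \<Sum>j. (if i = b then 0 else taboo Q b n i) * jump_ennreal Q i j)"
    by (simp only: taboo.simps) (rule ennreal_suminf_swap)
  also have "\<dots> = (\<Sum>i. if i = b then 0 else taboo Q b n i)"
    by (simp add: suminf_jump_ennreal[OF q] cong: if_cong)
  finally have "taboo Q b n b + (\<Sum>j. taboo Q b (Suc n) j) = (\<Sum>j. taboo Q b n j)"
    using suminf_split_off[of "taboo Q b n" b] by simp
  with Suc show ?case by (simp only: sum.lessThan_Suc add.assoc)
qed

text \<open>Expected number of visits to \<open>j\<close> from time 1 up to and including the first
  return to \<open>b\<close>. At \<open>j = b\<close> this is the return probability.\<close>

definition excursion_measure :: "(nat \<Rightarrow> nat \<Rightarrow> real) \<Rightarrow> nat \<Rightarrow> nat \<Rightarrow> ennreal" where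
  "excursion_measure Q b j = (\<Sum>n. taboo Q b n j)"

text \<open>Last-step decomposition: the jump into \<open>j\<close> is either the very first one,
  out of \<open>b\<close>, or it leaves a state \<open>i \<noteq> b\<close> visited earlier in the
  excursion.\<close>

lemma excursion_measure_unfold:
  "excursion_measure Q b j =
     jump_ennreal Q b j + (\<Sum>i. (if i = b then 0 else excursion_measure Q b i) * jump_ennreal Q i j)"
proof -
  have "(\<Sum>n. taboo Q b (Suc n) j)
      = (\<Sum>i. \<Sum>n. (if i = b then 0 else taboo Q b n i) * jump_ennreal Q i j)"
    by (simp only: taboo.simps) (rule ennreal_suminf_swap)
  also have "\<dots> = (\<Sum>i. (if i = b then 0 else excursion_measure Q b i) * jump_ennreal Q i j)"
    by (rule arg_cong[where f = suminf]) (auto simp: excursion_measure_def)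
  finally show ?thesis
    using suminf_offset[OF summableI, of "\<lambda>n. taboo Q b n j" 1]
    by (simp add: excursion_measure_def add.commute)
qed

text \<open>Induction on the number of steps: in the subinvariance inequality the term of
  \<open>b\<close> is split off, and at all other states \<open>z\<close> is bounded below by the
  induction hypothesis.\<close>

lemma excursion_measure_minimal:
  assumes sub: "\<And>j. (\<Sum>i. z i * jump_ennreal Q i j) \<le> z j"
  shows "z b * excursion_measure Q b j \<le> z j"
proof -
  have "z b * (\<Sum>k<n. taboo Q b k j) \<le> z j" for n j
  proof (induction n arbitrary: j)
    case 0
    show ?case by simp
  next
    case (Suc n)
    let ?t = "\<lambda>i. \<Sum>k<n. taboo Q b k i"
    have "(\<Sum>k<n. taboo Q b (Suc k) j)
        = (\<Sum>i. \<Sum>k<n. (if i = b then 0 else taboo Q b k i) * jump_ennreal Q i j)"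
      by (simp only: taboo.simps) (rule suminf_sum[symmetric], auto)
    also have "\<dots> = (\<Sum>i. (if i = b then 0 else ?t i) * jump_ennreal Q i j)"
      by (rule arg_cong[where f = suminf]) (auto simp: sum_distrib_right)
    finally have *: "(\<Sum>k<Suc n. taboo Q b k j)
        = jump_ennreal Q b j + (\<Sum>i. (if i = b then 0 else ?t i) * jump_ennreal Q i j)"
      by (simp add: sum.lessThan_Suc_shift del: sum.lessThan_Suc taboo.simps(2))
    have "z b * (\<Sum>k<Suc n. taboo Q b k j)
        = z b * jump_ennreal Q b j + (\<Sum>i. z b * ((if i = b then 0 else ?t i) * jump_ennreal Q i j))"
      unfolding * by (simp add: distrib_left)
    also have "\<dots> \<le> z b * jump_ennreal Q b j + (\<Sum>i. if i = b then 0 else z i * jump_ennreal Q i j)"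
      using Suc.IH by (intro add_left_mono suminf_le)
        (auto simp: mult.assoc[symmetric] intro!: mult_right_mono)
    also have "\<dots> = (\<Sum>i. z i * jump_ennreal Q i j)"
      using suminf_split_off[of "\<lambda>i. z i * jump_ennreal Q i j" b] by simp
    also have "\<dots> \<le> z j" by (rule sub)
    finally show ?case .
  qed
  then have "(\<Sum>n. z b * taboo Q b n j) \<le> z j"
    by (intro suminf_le_const) (auto simp: sum_distrib_left)
  then show ?thesis by (simp add: excursion_measure_def)
qed

text \<open>Moving the diagonal term of column \<open>j\<close> of \<open>\<pi> Q = 0\<close> to the
  other side, and weighting each state by its total jump rate, turns stationarity into invariance
  under the jump matrix.\<close>

lemma stationary_jump_invariant:
  assumes q: "q_matrix Q" and st: "stationary_distribution Q \<pi>"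
  shows "(\<Sum>i. ennreal (\<pi> i * - Q i i) * jump_ennreal Q i j) = ennreal (\<pi> j * - Q j j)"
proof -
  have p: "\<And>i. 0 < \<pi> i" and s: "(\<lambda>i. \<pi> i * Q i j) sums 0"
    using st by (auto simp: stationary_distribution_def)
  have d: "Q i i < 0" for i using q_matrix_diag_neg[OF q] .
  have "(\<lambda>i. \<pi> i * Q i j - (if i = j then \<pi> j * Q j j else 0)) sums (0 - \<pi> j * Q j j)"
    using s by (intro sums_diff) (use sums_single[of j "\<lambda>_. \<pi> j * Q j j"] in auto)
  also have "(\<lambda>i. \<pi> i * Q i j - (if i = j then \<pi> j * Q j j else 0))
      = (\<lambda>i. \<pi> i * - Q i i * jump_prob Q i j)"
    using d by (auto simp: jump_prob_def fun_eq_iff less_le)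
  finally have *: "(\<lambda>i. \<pi> i * - Q i i * jump_prob Q i j) sums (\<pi> j * - Q j j)" by simp
  have nn: "0 \<le> \<pi> i * - Q i i" for i
    using p[of i] d[of i] by (intro mult_nonneg_nonneg) auto
  have "(\<Sum>i. ennreal (\<pi> i * - Q i i) * jump_ennreal Q i j)
      = (\<Sum>i. ennreal (\<pi> i * - Q i i * jump_prob Q i j))"
    unfolding jump_ennreal_def
    by (rule arg_cong[where f = suminf], rule ext) (rule ennreal_mult[symmetric, OF nn jump_prob_nonneg[OF q]])
  also have "\<dots> = ennreal (\<pi> j * - Q j j)"
    by (intro suminf_ennreal_eq mult_nonneg_nonneg[OF nn jump_prob_nonneg[OF q]] *)
  finally show ?thesis .
qed

text \<open>
  For a recurrent chain the excursion measure is invariant, hence so is its nonnegative difference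
  to a stationary measure normalised at \<open>b\<close>; that difference vanishes at \<open>b\<close>, hence everywhere.
\<close>

lemma stationary_eq_excursion_measure:
  assumes q: "q_matrix Q" and irr: "irreducible_q_matrix Q" and st: "stationary_distribution Q \<pi>"
    and rec: "excursion_measure Q b b = 1"
  shows "ennreal (\<pi> j * - Q j j) = ennreal (\<pi> b * - Q b b) * excursion_measure Q b j"
proof -
  let ?p = "jump_ennreal Q" and ?t = "excursion_measure Q b"
  define \<nu> where "\<nu> i = ennreal (\<pi> i * - Q i i)" for i
  have inv: "(\<Sum>i. \<nu> i * ?p i j) = \<nu> j" for j
    using stationary_jump_invariant[OF q st] by (simp add: \<nu>_def)
  have le: "\<nu> b * ?t j \<le> \<nu> j" for j
    by (rule excursion_measure_minimal) (simp add: inv)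
  \<comment> \<open>Recurrence says \<open>?t b = 1\<close>, so the separate first term in the
    last-step decomposition is exactly the missing term \<open>i = b\<close> of the sum.\<close>
  have t_inv: "(\<Sum>i. ?t i * ?p i j) = ?t j" for j
  proof -
    have "(\<Sum>i. ?t i * ?p i j) = ?p b j + (\<Sum>i. if i = b then 0 else ?t i * ?p i j)"
      using suminf_split_off[of "\<lambda>i. ?t i * ?p i j" b] rec by simp
    also have "(\<lambda>i. if i = b then 0 else ?t i * ?p i j) = (\<lambda>i. (if i = b then 0 else ?t i) * ?p i j)"
      by auto
    finally show ?thesis using excursion_measure_unfold[of Q b j] by simp
  qed
  define d where "d i = \<nu> i - \<nu> b * ?t i" for i
  have split: "\<nu> i = \<nu> b * ?t i + d i" for i
    unfolding d_def by (rule add_diff_inverse_ennreal[OF le, symmetric])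
  have "{i. d i = 0} = UNIV"
  proof (rule irreducible_predecessor_closed[OF irr])
    show "b \<in> {i. d i = 0}" by (simp add: d_def rec ennreal_diff_self \<nu>_def)
  next
    fix i j assume j: "j \<in> {i. d i = 0}" and ij: "i \<noteq> j" "0 < Q i j"
    \<comment> \<open>Since \<open>\<nu>\<close> and the multiple of \<open>?t\<close> are both
      invariant, \<open>d\<close> has no inflow into its zero \<open>j\<close>. The cancellation in
      \<open>ennreal\<close> is justified because \<open>\<nu> j\<close> is finite.\<close>
    have "\<nu> j = (\<Sum>i. \<nu> b * (?t i * ?p i j) + d i * ?p i j)"
      using inv[of j] by (subst (asm) split) (simp add: distrib_right mult.assoc)
    also have "\<dots> = \<nu> b * ?t j + (\<Sum>i. d i * ?p i j)"
      by (simp add: suminf_add_ennreal t_inv)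
    finally have "\<nu> j + 0 = \<nu> j + (\<Sum>i. d i * ?p i j)"
      using split[of j] j by simp
    then have "(\<Sum>i. d i * ?p i j) = 0"
      by (subst (asm) ennreal_add_left_cancel) (simp add: \<nu>_def)
    moreover have "d i * ?p i j \<le> (\<Sum>i. d i * ?p i j)"
      using sum_le_suminf[OF summableI, of "{i}" "\<lambda>i. d i * ?p i j"] by simp
    ultimately have "d i * ?p i j = 0" by simp
    moreover have "?p i j \<noteq> 0"
      using ij q_matrix_diag_neg[OF q, of i]
      by (simp add: jump_ennreal_def jump_prob_def ennreal_eq_0_iff not_le divide_pos_neg)
    ultimately show "i \<in> {i. d i = 0}" by simp
  qed
  then show ?thesis using split[of j] by (auto simp: \<nu>_def)
qed

subsection \<open>Recurrence of the jump chain\<close>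

text \<open>The prescribed path of length \<open>r\<close> after the taboo period strengthens the
  induction on \<open>a\<close>: one taboo time at a time is traded for one more prescribed state,
  which replaces conditioning. Positivity of the holding times appears because the law of the chain
  is given on events \<open>t k < S k\<close>, taken here at \<open>t k = 0\<close>.\<close>

lemma emeasure_taboo_path:
  assumes mc: "markov_chain_with_generator Q P Y S"
  shows "emeasure (P b) {\<omega> \<in> space (P b). Y 0 \<omega> = b \<and> (\<forall>k\<in>{1..a}. Y k \<omega> \<noteq> b) \<and>
             (\<forall>k\<in>{a+1..a+1+r}. Y k \<omega> = x k) \<and> (\<forall>k\<le>a+1+r. 0 < S k \<omega>)}
       = taboo Q b a (x (a+1)) * (\<Prod>k<r. jump_ennreal Q (x (a+1+k)) (x (a+2+k)))"
proof (induction a arbitrary: r x)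
  case 0
  interpret prob_space "P b" using mc by (simp add: markov_chain_with_generator_def)
  have q: "q_matrix Q" using mc by (simp add: markov_chain_with_generator_def)
  \<comment> \<open>For \<open>a = 0\<close> every state is prescribed once \<open>x\<close> is
    corrected at 0, and the exponential factors are 1 at time 0.\<close>
  let ?x = "x(0 := b)"
  have "{\<omega> \<in> space (P b). Y 0 \<omega> = b \<and> (\<forall>k\<in>{1..0}. Y k \<omega> \<noteq> b) \<and>
          (\<forall>k\<in>{0+1..0+1+r}. Y k \<omega> = x k) \<and> (\<forall>k\<le>0+1+r. 0 < S k \<omega>)}
      = {\<omega> \<in> space (P b). \<forall>k\<le>Suc r. Y k \<omega> = ?x k \<and> (\<lambda>_. 0) k < S k \<omega>}"
    by (auto simp: Suc_le_eq)
  moreover have "measure (P b) {\<omega> \<in> space (P b). \<forall>k\<le>Suc r. Y k \<omega> = ?x k \<and> (\<lambda>_. 0) k < S k \<omega>}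
      = (\<Prod>k<Suc r. jump_prob Q (?x k) (?x (Suc k)))"
    using mc unfolding markov_chain_with_generator_def
    by (elim conjE allE[where x = b] allE[where x = "Suc r"] allE[where x = ?x] allE[where x = "\<lambda>_. 0"]) simp
  ultimately show ?case
    by (simp add: emeasure_eq_measure prod_ennreal[symmetric] jump_prob_nonneg[OF q]
        prod.lessThan_Suc_shift ennreal_mult prod_nonneg jump_ennreal_def
        del: prod.lessThan_Suc)
next
  case (Suc a)
  have Y[measurable]: "Y n \<in> measurable (P b) (count_space UNIV)"
    and S[measurable]: "S n \<in> borel_measurable (P b)" for n
    using mc by (auto simp: markov_chain_with_generator_def)
  define E where "E a r x = {\<omega> \<in> space (P b). Y 0 \<omega> = b \<and> (\<forall>k\<in>{1..a}. Y k \<omega> \<noteq> b) \<and>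
             (\<forall>k\<in>{a+1..a+1+r}. Y k \<omega> = x k) \<and> (\<forall>k\<le>a+1+r. 0 < S k \<omega>)}" for a r and x :: "nat \<Rightarrow> nat"
  have sets: "E a r x \<in> sets (P b)" for a r x
    unfolding E_def by measurable
  \<comment> \<open>The event is split by the state \<open>i \<noteq> b\<close> at the last taboo
    time, which becomes the first prescribed state of a path that is longer by one.\<close>
  let ?F = "\<lambda>i. if i = b then {} else E a (Suc r) (x(Suc a := i))"
  let ?R = "\<Prod>k<r. jump_ennreal Q (x (Suc a+1+k)) (x (Suc a+2+k))"
  have "E (Suc a) r x = (\<Union>i. ?F i)"
  proof (intro equalityI subsetI)
    fix \<omega> assume w: "\<omega> \<in> E (Suc a) r x"
    then have "Y (Suc a) \<omega> \<noteq> b" by (auto simp: E_def)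
    moreover have "\<omega> \<in> E a (Suc r) (x(Suc a := Y (Suc a) \<omega>))"
      using w unfolding E_def by auto
    ultimately show "\<omega> \<in> (\<Union>i. ?F i)" by auto
  next
    fix \<omega> assume "\<omega> \<in> (\<Union>i. ?F i)"
    then obtain i where i: "i \<noteq> b" "\<omega> \<in> E a (Suc r) (x(Suc a := i))"
      by (auto split: if_splits)
    then have "Y (Suc a) \<omega> = i" by (auto simp: E_def)
    moreover have "Y k \<omega> = x k" if "k \<in> {Suc a+1..Suc a+1+r}" for k
    proof -
      have "Y k \<omega> = (x(Suc a := i)) k" using i(2) that unfolding E_def by simp
      with that show ?thesis by simp
    qed
    moreover have "Y 0 \<omega> = b" "\<forall>k\<in>{1..a}. Y k \<omega> \<noteq> b" "\<omega> \<in> space (P b)"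
      "\<forall>k\<le>Suc a+1+r. 0 < S k \<omega>" using i(2) by (auto simp: E_def)
    ultimately show "\<omega> \<in> E (Suc a) r x"
      using i(1) unfolding E_def by (simp add: atLeastAtMostSuc_conv)
  qed
  then have "emeasure (P b) (E (Suc a) r x) = emeasure (P b) (\<Union>i. ?F i)"
    by (rule arg_cong)
  also have "\<dots> = (\<Sum>i. emeasure (P b) (?F i))"
  proof (rule suminf_emeasure[symmetric])
    show "range ?F \<subseteq> sets (P b)" using sets by auto
    have "i = j" if "\<omega> \<in> ?F i" "\<omega> \<in> ?F j" for i j \<omega>
    proof -
      have "Y (Suc a) \<omega> = i" "Y (Suc a) \<omega> = j"
        using that by (auto simp: E_def split: if_splits)
      then show ?thesis by simp
    qed
    then show "disjoint_family ?F"
      unfolding disjoint_family_on_def by blast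
  qed
  also have "\<dots> = (\<Sum>i. (if i = b then 0 else taboo Q b a i) * jump_ennreal Q i (x (Suc a + 1)) * ?R)"
  proof (rule arg_cong[where f = suminf], rule ext)
    fix i
    have "emeasure (P b) (E a (Suc r) (x(Suc a := i)))
        = taboo Q b a i * (jump_ennreal Q i (x (Suc a + 1)) * ?R)"
      unfolding E_def Suc.IH by (simp add: prod.lessThan_Suc_shift del: prod.lessThan_Suc)
    then show "emeasure (P b) (?F i)
        = (if i = b then 0 else taboo Q b a i) * jump_ennreal Q i (x (Suc a + 1)) * ?R"
      by (simp add: mult.assoc)
  qed
  also have "\<dots> = taboo Q b (Suc a) (x (Suc a + 1)) * ?R" by simp
  finally show ?case unfolding E_def .
qed

text \<open>On the event that \<open>Y\<close> never returns to \<open>b\<close>, the return time is an infimum over the empty set.\<close>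

lemma never_returning_null:
  assumes mc: "markov_chain_with_generator Q P Y S" and pr: "positive_recurrent P Y S"
  shows "emeasure (P b) {\<omega> \<in> space (P b). \<forall>k\<ge>1. Y k \<omega> \<noteq> b} = 0"
proof -
  have [measurable]: "Y n \<in> measurable (P b) (count_space UNIV)" for n
    using mc by (auto simp: markov_chain_with_generator_def)
  let ?N = "{\<omega> \<in> space (P b). \<forall>k\<ge>1. Y k \<omega> \<noteq> b}"
  have [measurable]: "?N \<in> sets (P b)" by measurable
  have "return_time Y S b \<omega> = \<infinity>" if "\<omega> \<in> ?N" for \<omega>
  proof -
    have "occupation_times Y S b \<omega> \<inter> {jump_time S 1 \<omega>..} = {}"
    proof (rule ccontr)
      assume "\<not> ?thesis"
      then obtain t n where "t < jump_time S (Suc n) \<omega>" "Y n \<omega> = b" "jump_time S 1 \<omega> \<le> t"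
        by (auto simp: occupation_times_def)
      \<comment> \<open>An occupation interval with \<open>n = 0\<close> ends at the first jump, and
        \<open>n \<ge> 1\<close> is excluded on this event.\<close>
      then show False using that by (cases n) auto
    qed
    then show ?thesis by (simp add: return_time_def)
  qed
  then have "(\<integral>\<^sup>+ \<omega>. \<infinity> * indicator ?N \<omega> \<partial>P b) \<le> (\<integral>\<^sup>+ \<omega>. return_time Y S b \<omega> \<partial>P b)"
    by (intro nn_integral_mono) (auto simp: indicator_def)
  also have "\<dots> < \<infinity>" using pr by (auto simp: positive_recurrent_def)
  finally have "\<infinity> * emeasure (P b) ?N < \<infinity>"
    by (subst (asm) nn_integral_cmult_indicator) auto
  then show ?thesis by (auto simp: ennreal_top_mult split: if_splits)
qed

text \<open>In the conservation of mass the part not yet returned is at most the probability of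
  avoiding \<open>b\<close> up to time \<open>a\<close>, which decreases to the null event of never
  returning.\<close>

lemma excursion_measure_self:
  assumes mc: "markov_chain_with_generator Q P Y S" and pr: "positive_recurrent P Y S"
  shows "excursion_measure Q b b = 1"
proof -
  interpret prob_space "P b" using mc by (simp add: markov_chain_with_generator_def)
  have q: "q_matrix Q" using mc by (simp add: markov_chain_with_generator_def)
  have [measurable]: "Y n \<in> measurable (P b) (count_space UNIV)"
     "S n \<in> borel_measurable (P b)" for n
    using mc by (auto simp: markov_chain_with_generator_def)
  define N where "N a = {\<omega> \<in> space (P b). \<forall>k\<in>{1..a}. Y k \<omega> \<noteq> b}" for a
  have N[measurable]: "N a \<in> sets (P b)" for a unfolding N_def by measurable
  have "(\<lambda>a. emeasure (P b) (N a)) \<longlonglongrightarrow> emeasure (P b) (\<Inter>a. N a)"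
    by (rule Lim_emeasure_decseq) (auto simp: N_def decseq_def)
  also have "(\<Inter>a. N a) = {\<omega> \<in> space (P b). \<forall>k\<ge>1. Y k \<omega> \<noteq> b}"
    by (auto simp: N_def) (metis One_nat_def atLeastAtMost_iff order_refl)
  finally have lim: "(\<lambda>a. emeasure (P b) (N a)) \<longlonglongrightarrow> 0"
    using never_returning_null[OF mc pr] by simp
  \<comment> \<open>An inequality suffices: the events \<open>E j\<close> also demand the initial
    state \<open>b\<close> and positive holding times.\<close>
  have le: "(\<Sum>j. taboo Q b a j) \<le> emeasure (P b) (N a)" for a
  proof -
    define E where "E j = {\<omega> \<in> space (P b). Y 0 \<omega> = b \<and> (\<forall>k\<in>{1..a}. Y k \<omega> \<noteq> b) \<and>
             (\<forall>k\<in>{a+1..a+1+0}. Y k \<omega> = (\<lambda>_. j) k) \<and> (\<forall>k\<le>a+1+0. 0 < S k \<omega>)}" for j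
    have E: "E j \<in> sets (P b)" for j unfolding E_def by measurable
    have "(\<Sum>j. taboo Q b a j) = (\<Sum>j. emeasure (P b) (E j))"
      unfolding E_def emeasure_taboo_path[OF mc] by simp
    also have "\<dots> = emeasure (P b) (\<Union>j. E j)"
      by (rule suminf_emeasure) (auto simp: E disjoint_family_on_def, auto simp: E_def)
    also have "\<dots> \<le> emeasure (P b) (N a)"
      by (rule emeasure_mono) (auto simp: E_def N_def)
    finally show ?thesis .
  qed
  have "(\<lambda>a. \<Sum>j. taboo Q b a j) \<longlonglongrightarrow> 0"
    by (rule tendsto_sandwich[OF _ _ tendsto_const lim]) (auto simp: le)
  then have "(\<lambda>n. (\<Sum>k<n. taboo Q b k b) + (\<Sum>j. taboo Q b n j)) \<longlonglongrightarrow> excursion_measure Q b b + 0"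
    unfolding excursion_measure_def by (intro tendsto_add summable_LIMSEQ) auto
  then show ?thesis
    unfolding taboo_mass[OF q] by (simp add: LIMSEQ_const_iff)
qed

subsection \<open>Ratio limits of subinvariant vectors\<close>

lemma liminf_mult_right_le:
  fixes f :: "nat \<Rightarrow> ennreal"
  shows "liminf f * c \<le> liminf (\<lambda>n. f n * c)"
  unfolding liminf_SUP_INF SUP_mult_right_ennreal
  by (intro SUP_mono' INF_greatest mult_right_mono INF_lower) auto

lemma subinvariant_ratio_eventually_gt:
  assumes q: "q_matrix Q" and irr: "irreducible_q_matrix Q" and st: "stationary_distribution Q \<pi>"
    and rec: "excursion_measure Q b b = 1"
    and n: "filterlim n at_top sequentially"
    and pos: "\<And>s i. i < n s \<Longrightarrow> 0 < X s i"
    and sub: "\<And>j. eventually (\<lambda>s. (\<Sum>i<n s. X s i * Q i j) \<le> 0) sequentially"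
    and c: "c < \<pi> j / \<pi> b"
  shows "eventually (\<lambda>s. c < X s j / X s b) sequentially"
proof -
  have p: "0 < \<pi> i" for i using st by (auto simp: stationary_distribution_def)
  have d: "Q i i < 0" for i using q_matrix_diag_neg[OF q] .
  have ev_in: "eventually (\<lambda>s. i < n s) sequentially" for i
    using n eventually_gt_at_top[of i] unfolding filterlim_iff by blast
  \<comment> \<open>Weighting by the jump rates passes from \<open>Q\<close> to the jump chain, and
    the denominator normalises at \<open>b\<close>. Extending by zero beyond the truncation then
    gives subinvariance at each fixed state for all large \<open>s\<close>.\<close>
  define w where "w s i = X s i * - Q i i / (X s b * - Q b b)" for s i
  define z where "z s i = (if i < n s then ennreal (w s i) else 0)" for s i
  have z_sub: "eventually (\<lambda>s. (\<Sum>i. z s i * jump_ennreal Q i k) \<le> z s k) sequentially" for k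
    using sub[of k] ev_in[of k] ev_in[of b]
  proof eventually_elim
    case (elim s)
    let ?D = "X s b * - Q b b"
    have D: "0 < ?D" using pos[OF elim(3)] d[of b] by (simp add: mult_pos_neg)
    have w_nn: "0 \<le> w s i" if "i < n s" for i
      unfolding w_def using pos[OF that] d[of i] D
      by (intro divide_nonneg_pos mult_nonneg_nonneg) auto
    have "(\<Sum>i. z s i * jump_ennreal Q i k) = (\<Sum>i<n s. z s i * jump_ennreal Q i k)"
      by (rule suminf_finite) (auto simp: z_def)
    also have "\<dots> = (\<Sum>i<n s. ennreal (w s i * jump_prob Q i k))"
      by (rule sum.cong) (auto simp: z_def jump_ennreal_def ennreal_mult w_nn jump_prob_nonneg[OF q])
    also have "\<dots> = ennreal (\<Sum>i<n s. w s i * jump_prob Q i k)"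
      by (rule sum_ennreal) (auto simp: w_nn jump_prob_nonneg[OF q])
    also have "(\<Sum>i<n s. w s i * jump_prob Q i k)
        = (\<Sum>i<n s. (X s i * Q i k - (if i = k then X s k * Q k k else 0)) / ?D)"
      using d by (intro sum.cong) (auto simp: w_def jump_prob_def less_le)
    also have "\<dots> = ((\<Sum>i<n s. X s i * Q i k) - X s k * Q k k) / ?D"
      unfolding sum_divide_distrib[symmetric] sum_subtractf using elim(2) by simp
    also have "\<dots> \<le> w s k"
      unfolding w_def using elim(1) D by (intro divide_right_mono) auto
    finally show ?case using elim(2) by (simp add: z_def ennreal_leI)
  qed
  define \<zeta> where "\<zeta> i = liminf (\<lambda>s. z s i)" for i
  have "\<zeta> b * excursion_measure Q b j \<le> \<zeta> j"
  proof (rule excursion_measure_minimal)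
    fix k
    \<comment> \<open>Fatou's lemma for the counting measure carries subinvariance over to the lower
      limit.\<close>
    have "(\<Sum>i. \<zeta> i * jump_ennreal Q i k) \<le> (\<Sum>i. liminf (\<lambda>s. z s i * jump_ennreal Q i k))"
      unfolding \<zeta>_def by (intro suminf_le liminf_mult_right_le) auto
    also have "\<dots> \<le> liminf (\<lambda>s. \<Sum>i. z s i * jump_ennreal Q i k)"
      using nn_integral_liminf[of "\<lambda>s i. z s i * jump_ennreal Q i k" "count_space UNIV"]
      by (simp add: nn_integral_count_space_nat)
    also have "\<dots> \<le> \<zeta> k"
      unfolding \<zeta>_def by (rule Liminf_mono) (rule z_sub)
    finally show "(\<Sum>i. \<zeta> i * jump_ennreal Q i k) \<le> \<zeta> k" .
  qed
  moreover have "1 \<le> \<zeta> b"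
    unfolding \<zeta>_def
  proof (rule Liminf_bounded)
    show "eventually (\<lambda>s. 1 \<le> z s b) sequentially"
      using ev_in[of b]
    proof eventually_elim
      case (elim s)
      with pos[OF elim] d[of b] show ?case by (simp add: z_def w_def)
    qed
  qed
  ultimately have ge: "excursion_measure Q b j \<le> \<zeta> j"
    using mult_right_mono[of 1 "\<zeta> b" "excursion_measure Q b j"] by simp
  have \<nu>: "0 < \<pi> i * - Q i i" for i using p[of i] d[of i] by (simp add: mult_pos_neg)
  have ex: "ennreal (\<pi> j * - Q j j / (\<pi> b * - Q b b)) = excursion_measure Q b j"
  proof -
    have "ennreal (\<pi> j * - Q j j / (\<pi> b * - Q b b))
        = ennreal (\<pi> j * - Q j j) / ennreal (\<pi> b * - Q b b)"
      by (rule divide_ennreal[symmetric, OF less_imp_le[OF \<nu>] \<nu>])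
    also have "\<dots> = excursion_measure Q b j * ennreal (\<pi> b * - Q b b) / ennreal (\<pi> b * - Q b b)"
      by (simp only: stationary_eq_excursion_measure[OF q irr st rec, of j] mult.commute)
    also have "\<dots> = excursion_measure Q b j"
      using \<nu>[of b] by (intro ennreal_mult_divide_eq) (auto simp: ennreal_eq_0_iff not_le)
    finally show ?thesis .
  qed
  \<comment> \<open>The factor by which ratios of the rate-weighted vectors differ from the
    unweighted ratios.\<close>
  let ?r = "- Q j j / - Q b b"
  have r: "0 < ?r" using d by (simp add: divide_neg_neg)
  \<comment> \<open>A negative \<open>c\<close> is raised to 0 so that \<open>ennreal\<close>
    preserves the comparison; the bound stays strict because \<open>\<pi>\<close> is
    positive.\<close>
  let ?c = "max c 0"
  have "?c < \<pi> j / \<pi> b" using c p by simp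
  then have "?c * ?r < \<pi> j / \<pi> b * ?r" using r by (rule mult_strict_right_mono)
  also have "\<dots> = \<pi> j * - Q j j / (\<pi> b * - Q b b)" by simp
  finally have "ennreal (?c * ?r) < ennreal (\<pi> j * - Q j j / (\<pi> b * - Q b b))"
    by (intro ennreal_lessI divide_pos_pos \<nu>)
  then have "ennreal (?c * ?r) < \<zeta> j" using ge ex by simp
  then have "eventually (\<lambda>s. ennreal (?c * ?r) < z s j) sequentially"
    unfolding \<zeta>_def by (rule less_LiminfD)
  then show ?thesis using ev_in[of j] ev_in[of b]
  proof eventually_elim
    case (elim s)
    then have "ennreal (?c * ?r) < ennreal (w s j)" by (simp add: z_def)
    moreover have "0 \<le> ?c * ?r" using r by (intro mult_nonneg_nonneg) auto
    ultimately have "?c * ?r < w s j" by (simp only: ennreal_less_iff)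
    also have "w s j = X s j / X s b * ?r" by (simp add: w_def)
    finally have "?c < X s j / X s b" using r by (simp only: mult_less_cancel_right_pos)
    then show ?case by simp
  qed
qed

lemma subinvariant_ratio_tendsto:
  assumes q: "q_matrix Q" and irr: "irreducible_q_matrix Q" and st: "stationary_distribution Q \<pi>"
    and rec: "\<And>b. excursion_measure Q b b = 1"
    and n: "filterlim n at_top sequentially"
    and pos: "\<And>s i. i < n s \<Longrightarrow> 0 < X s i"
    and sub: "\<And>j. eventually (\<lambda>s. (\<Sum>i<n s. X s i * Q i j) \<le> 0) sequentially"
  shows "(\<lambda>s. X s j / X s b) \<longlonglongrightarrow> \<pi> j / \<pi> b"
proof (rule order_tendstoI)
  fix a assume "a < \<pi> j / \<pi> b"
  from subinvariant_ratio_eventually_gt[OF q irr st rec n _ sub this]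
  show "eventually (\<lambda>s. a < X s j / X s b) sequentially"
    using pos by blast
next
  fix a assume a: "\<pi> j / \<pi> b < a"
  have p: "0 < \<pi> i" for i using st by (auto simp: stationary_distribution_def)
  have ev_in: "eventually (\<lambda>s. i < n s) sequentially" for i
    using n eventually_gt_at_top[of i] unfolding filterlim_iff by blast
  have a0: "0 < a" using a p[of j] p[of b] by (meson divide_pos_pos less_trans)
  \<comment> \<open>An upper bound on a ratio is a lower bound on its reciprocal, so the one-sided
    result is applied with \<open>j\<close> and \<open>b\<close> exchanged.\<close>
  with a p have "1 / a < \<pi> b / \<pi> j" by (simp add: field_simps)
  from subinvariant_ratio_eventually_gt[OF q irr st rec n _ sub this]
  have "eventually (\<lambda>s. 1 / a < X s b / X s j) sequentially"
    using pos by blast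
  then show "eventually (\<lambda>s. X s j / X s b < a) sequentially"
    using ev_in[of j] ev_in[of b]
  proof eventually_elim
    case (elim s)
    with pos[OF elim(2)] pos[OF elim(3)] a0 show ?case by (simp add: field_simps)
  qed
qed

subsection \<open>Block elimination\<close>

lemma times_mat_entry:
  assumes "A \<in> carrier_mat r n" "B \<in> carrier_mat n c" "i < r" "j < c"
  shows "(A * B) $$ (i, j) = (\<Sum>a<n. A $$ (i, a) * B $$ (a, j))"
  using assms by (auto simp: scalar_prod_def atLeast0LessThan intro!: sum.cong)

lemma mat_sum_carrier [simp]: "mat_sum r c f A \<in> carrier_mat r c"
  by (simp add: mat_sum_def)

lemma times_mat_sum_entry:
  assumes z: "z \<in> carrier_mat r n" and f: "\<And>l. l \<in> A \<Longrightarrow> f l \<in> carrier_mat n p"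
    and ic: "i < r" "c < p"
  shows "(z * mat_sum n p f A) $$ (i, c) = (\<Sum>l\<in>A. (z * f l) $$ (i, c))"
proof -
  have "(z * mat_sum n p f A) $$ (i, c) = (\<Sum>a<n. z $$ (i, a) * (\<Sum>l\<in>A. f l $$ (a, c)))"
    using z ic by (subst times_mat_entry) (auto simp: mat_sum_def)
  also have "\<dots> = (\<Sum>l\<in>A. \<Sum>a<n. z $$ (i, a) * f l $$ (a, c))"
    unfolding sum_distrib_left by (rule sum.swap)
  also have "\<dots> = (\<Sum>l\<in>A. (z * f l) $$ (i, c))"
    using times_mat_entry[OF z f] ic by simp
  finally show ?thesis .
qed

text \<open>A vanishing determinant would give the transpose a nontrivial kernel vector, which read
  as a row contradicts injectivity. With a nonzero determinant \<open>mat_inverse\<close> does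
  return a matrix.\<close>

lemma mat_inv_if_row_injective:
  assumes A: "A \<in> carrier_mat n n"
    and inj: "\<And>z. z \<in> carrier_mat 1 n \<Longrightarrow> z * A = 0\<^sub>m 1 n \<Longrightarrow> z = 0\<^sub>m 1 n"
  shows "mat_inv A \<in> carrier_mat n n \<and> mat_inv A * A = 1\<^sub>m n"
proof -
  have "det A \<noteq> 0"
  proof
    assume "det A = 0"
    then have "det (transpose_mat A) = 0" using det_transpose[OF A] by simp
    then obtain v where v: "v \<in> carrier_vec n" "v \<noteq> 0\<^sub>v n" "transpose_mat A *\<^sub>v v = 0\<^sub>v n"
      using det_0_iff_vec_prod_zero_field[of "transpose_mat A" n] A by auto
    define z where "z = mat 1 n (\<lambda>(_, j). v $ j)"
    have z: "z \<in> carrier_mat 1 n" by (simp add: z_def)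
    have "z * A = 0\<^sub>m 1 n"
    proof (rule eq_matI)
      fix i j assume "i < dim_row (0\<^sub>m 1 n)" "j < dim_col (0\<^sub>m 1 n)"
      then have i: "i = 0" and j: "j < n" by auto
      have "(z * A) $$ (i, j) = (\<Sum>a<n. v $ a * A $$ (a, j))"
        using times_mat_entry[OF z A] i j by (simp add: z_def)
      also have "\<dots> = (transpose_mat A *\<^sub>v v) $ j"
        using A v(1) j by (auto simp: scalar_prod_def atLeast0LessThan mult.commute intro!: sum.cong)
      also have "\<dots> = 0" using v(3) j by simp
      finally show "(z * A) $$ (i, j) = 0\<^sub>m 1 n $$ (i, j)" using i j by simp
    qed (use z A in auto)
    from inj[OF z this] have "z $$ (0, j) = 0" if "j < n" for j
      using that by simp
    then have "v = 0\<^sub>v n" using v(1) by (intro eq_vecI) (auto simp: z_def)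
    with v(2) show False by simp
  qed
  from det_non_zero_imp_unit[OF A this, of "()"]
  obtain B where "mat_inverse A = Some B"
    using mat_inverse(1)[OF A, of "()"] by (cases "mat_inverse A") auto
  then show ?thesis using mat_inverse(2)[OF A] by (simp add: mat_inv_def)
qed

section \<open>Arithmetic of levels and blocks\<close>

lemma level_start_Suc: "level_start m (Suc k) = level_start m k + m k"
  by (simp add: level_start_def)

lemma level_start_mono: "k \<le> l \<Longrightarrow> level_start m k \<le> level_start m l"
  unfolding level_start_def by (rule sum_mono2) auto

lemma le_level_start: "\<forall>k. 0 < m k \<Longrightarrow> k \<le> level_start m k"
proof (induction k)
  case (Suc k)
  then have "k \<le> level_start m k" "0 < m k" by auto
  then show ?case by (simp add: level_start_Suc)
qed simp

lemma level_decomposition: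
  assumes "i < level_start m n"
  obtains l a where "l < n" "a < m l" "i = level_start m l + a"
  using assms
proof (induction n arbitrary: thesis)
  case 0
  then show ?case by (simp add: level_start_def)
next
  case (Suc n)
  show ?case
  proof (cases "i < level_start m n")
    case True
    show ?thesis by (rule Suc.IH[OF _ True]) (auto intro: Suc.prems(1) less_SucI)
  next
    case False
    with Suc.prems show ?thesis by (intro Suc.prems(1)[of n "i - level_start m n"]) (auto simp: level_start_Suc)
  qed
qed

lemma sum_lessThan_add: "(\<Sum>i<a + b. f i) = (\<Sum>i<a. f i) + (\<Sum>i<b. f (a + i))"
  for f :: "nat \<Rightarrow> 'a :: comm_monoid_add"
  by (induction b) (simp_all add: add.assoc)

lemma sum_lessThan_level_start:
  "(\<Sum>i<level_start m n. f i) = (\<Sum>l<n. \<Sum>a<m l. f (level_start m l + a))"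
  for f :: "nat \<Rightarrow> 'a :: comm_monoid_add"
  by (induction n) (simp_all add: level_start_Suc sum_lessThan_add, simp add: level_start_def)

definition level_of :: "(nat \<Rightarrow> nat) \<Rightarrow> nat \<Rightarrow> nat" where
  "level_of m i = (LEAST l. i < level_start m (Suc l))"

text \<open>Glues row blocks into one function on the states, the form to which the minimum
  principle and the ratio limits apply.\<close>

definition block_entry :: "(nat \<Rightarrow> nat) \<Rightarrow> (nat \<Rightarrow> real mat) \<Rightarrow> nat \<Rightarrow> real" where
  "block_entry m y i = y (level_of m i) $$ (0, i - level_start m (level_of m i))"

lemma block_entry_level:
  assumes "a < m l"
  shows "block_entry m y (level_start m l + a) = y l $$ (0, a)"
proof -
  have "level_of m (level_start m l + a) = l"
    unfolding level_of_def
  proof (rule Least_equality)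
    show "level_start m l + a < level_start m (Suc l)" using assms by (simp add: level_start_Suc)
  next
    fix k assume "level_start m l + a < level_start m (Suc k)"
    then show "l \<le> k" using level_start_mono[of "Suc k" l m] by (cases "Suc k \<le> l") auto
  qed
  then show ?thesis by (simp add: block_entry_def)
qed

section \<open>Schur complements and left systems of the truncations\<close>

lemma Q_block_carrier [simp]: "Q_block Q m k l \<in> carrier_mat (m k) (m l)"
  by (simp add: Q_block_def)

lemma upper_block_hessenberg_entry:
  assumes "upper_block_hessenberg Q m" "l + 2 \<le> k" "a < m k" "b < m l"
  shows "Q (level_start m k + a) (level_start m l + b) = 0"
proof -
  have "Q_block Q m k l $$ (a, b) = 0\<^sub>m (m k) (m l) $$ (a, b)"
    using assms by (simp add: upper_block_hessenberg_def)
  then show ?thesis using assms by (simp add: Q_block_def)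
qed

text \<open>The matrix inverted in the definition of \<open>U_star\<close>, up to sign.\<close>

definition level_schur :: "(nat \<Rightarrow> nat \<Rightarrow> real) \<Rightarrow> (nat \<Rightarrow> nat) \<Rightarrow> nat \<Rightarrow> real mat" where
  "level_schur Q m k =
     Q_block Q m k k + mat_sum (m k) (m k) (\<lambda>l. U_prod Q m k l * Q_block Q m l k) {..<k}"

lemma level_schur_carrier [simp]: "level_schur Q m k \<in> carrier_mat (m k) (m k)"
  by (simp add: level_schur_def)

lemma U_star_eq: "U_star Q m k = mat_inv (- level_schur Q m k)"
proof (cases k)
  case 0
  have "level_schur Q m 0 = Q_block Q m 0 0"
    by (rule eq_matI) (auto simp: level_schur_def mat_sum_def Q_block_def)
  with 0 show ?thesis by simp
next
  case (Suc j)
  have "- level_schur Q m (Suc j) = - Q_block Q m (Suc j) (Suc j)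
       - mat_sum (m (Suc j)) (m (Suc j)) (\<lambda>l. U_prod Q m (Suc j) l * Q_block Q m l (Suc j)) {..j}"
    by (rule eq_matI)
      (auto simp: level_schur_def mat_sum_def Q_block_def lessThan_Suc_atMost simp del: U_prod.simps)
  with Suc show ?thesis by simp
qed

lemma U_prod_self: "U_prod Q m k k = 1\<^sub>m (m k)"
  by (cases k) auto

text \<open>Dimension and inverse relation are bundled because both must be known at all lower
  levels before invertibility at the next level can be shown.\<close>

definition U_star_inverts :: "(nat \<Rightarrow> nat \<Rightarrow> real) \<Rightarrow> (nat \<Rightarrow> nat) \<Rightarrow> nat \<Rightarrow> bool" where
  "U_star_inverts Q m k \<longleftrightarrow> U_star Q m k \<in> carrier_mat (m k) (m k) \<and>
     U_star Q m k * level_schur Q m k = - 1\<^sub>m (m k)"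

lemma U_prod_carrier:
  assumes "\<And>l. l < k \<Longrightarrow> U_star_inverts Q m l" "l \<le> k"
  shows "U_prod Q m k l \<in> carrier_mat (m k) (m l)"
  using assms
proof (induction k)
  case (Suc k)
  show ?case
  proof (cases "l \<le> k")
    case True
    have "Q_block Q m (Suc k) k * U_star Q m k \<in> carrier_mat (m (Suc k)) (m k)"
      using Suc.prems(1)[of k] by (intro mult_carrier_mat[of _ _ "m k"]) (auto simp: U_star_inverts_def)
    moreover have "U_prod Q m k l \<in> carrier_mat (m k) (m l)"
      using Suc True by auto
    ultimately show ?thesis using True by simp
  qed (use Suc.prems in \<open>auto simp: le_Suc_eq\<close>)
qed auto

text \<open>Block elimination by induction on \<open>k\<close>. In the last block column the sum
  assembles the Schur complement; in every earlier column the contribution of the top level cancels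
  what the lower levels leave.\<close>

lemma hessenberg_row_identity:
  assumes hess: "upper_block_hessenberg Q m"
    and inv: "\<And>l. l < k \<Longrightarrow> U_star_inverts Q m l"
    and z: "z \<in> carrier_mat 1 (m k)" and jc: "j \<le> k" "c < m j"
  shows "(\<Sum>l\<le>k. (z * U_prod Q m k l * Q_block Q m l j) $$ (0, c))
       = (if j = k then (z * level_schur Q m k) $$ (0, c) else 0)"
  using inv z jc
proof (induction k arbitrary: z)
  case 0
  have "level_schur Q m 0 = Q_block Q m 0 0"
    by (rule eq_matI) (auto simp: level_schur_def mat_sum_def Q_block_def)
  with 0 show ?case by simp
next
  case (Suc k)
  have U: "U_prod Q m (Suc k) l \<in> carrier_mat (m (Suc k)) (m l)" if "l \<le> Suc k" for l
    using U_prod_carrier[of "Suc k"] Suc.prems(1) that by blast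
  have z: "z \<in> carrier_mat 1 (m (Suc k))" by fact
  show ?case
  proof (cases "j = Suc k")
    case True
    have c: "c < m (Suc k)" using Suc.prems True by simp
    have sum: "(z * mat_sum (m (Suc k)) (m (Suc k)) (\<lambda>l. U_prod Q m (Suc k) l * Q_block Q m l (Suc k)) {..<Suc k}) $$ (0, c)
        = (\<Sum>l<Suc k. (z * (U_prod Q m (Suc k) l * Q_block Q m l (Suc k))) $$ (0, c))"
    proof (rule times_mat_sum_entry[OF z])
      fix l assume "l \<in> {..<Suc k}"
      then show "U_prod Q m (Suc k) l * Q_block Q m l (Suc k) \<in> carrier_mat (m (Suc k)) (m (Suc k))"
        using U[of l] by (intro mult_carrier_mat[of _ _ "m l"]) (auto simp del: U_prod.simps)
    qed (use c in auto)
    have assoc: "z * (U_prod Q m (Suc k) l * Q_block Q m l (Suc k))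
        = z * U_prod Q m (Suc k) l * Q_block Q m l (Suc k)" if "l \<le> Suc k" for l
      using assoc_mult_mat[OF z U[OF that], of "Q_block Q m l (Suc k)" "m (Suc k)"] by simp
    have "(z * level_schur Q m (Suc k)) $$ (0, c)
        = (z * Q_block Q m (Suc k) (Suc k)) $$ (0, c)
          + (\<Sum>l<Suc k. (z * (U_prod Q m (Suc k) l * Q_block Q m l (Suc k))) $$ (0, c))"
      unfolding level_schur_def
        sum[symmetric] mult_add_distrib_mat[OF z Q_block_carrier[of Q m "Suc k" "Suc k"]
          mat_sum_carrier[of "m (Suc k)" "m (Suc k)"]]
      by (rule index_add_mat(1))
        (use z c in \<open>auto simp: carrier_matD[OF mat_sum_carrier] simp del: U_prod.simps\<close>)
    also have "\<dots> = (\<Sum>l\<le>Suc k. (z * U_prod Q m (Suc k) l * Q_block Q m l (Suc k)) $$ (0, c))"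
      using z assoc by (simp add: lessThan_Suc_atMost U_prod_self del: U_prod.simps)
    finally show ?thesis using True by simp
  next
    case False
    with Suc.prems have j: "j \<le> k" by simp
    have inv: "U_star_inverts Q m k" using Suc.prems(1) by simp
    then have Us: "U_star Q m k \<in> carrier_mat (m k) (m k)" by (simp add: U_star_inverts_def)
    have B: "Q_block Q m (Suc k) k \<in> carrier_mat (m (Suc k)) (m k)" by simp
    \<comment> \<open>Peeling the leftmost factor off \<open>U_prod\<close> leaves the same sum one
      level lower, for the row vector \<open>y * U_star Q m k\<close>.\<close>
    define y where "y = z * Q_block Q m (Suc k) k"
    have y: "y \<in> carrier_mat 1 (m k)"
      unfolding y_def by (rule mult_carrier_mat[OF z B])
    have yU: "y * U_star Q m k \<in> carrier_mat 1 (m k)" by (rule mult_carrier_mat[OF y Us])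
    have step: "z * U_prod Q m (Suc k) l = y * U_star Q m k * U_prod Q m k l" if "l \<le> k" for l
    proof -
      have Ul: "U_prod Q m k l \<in> carrier_mat (m k) (m l)"
        using U_prod_carrier[of k Q m l] Suc.prems(1) that by simp
      have "z * U_prod Q m (Suc k) l = z * ((Q_block Q m (Suc k) k * U_star Q m k) * U_prod Q m k l)"
        using that by simp
      also have "\<dots> = z * (Q_block Q m (Suc k) k * U_star Q m k) * U_prod Q m k l"
        by (rule assoc_mult_mat[OF z mult_carrier_mat[OF B Us] Ul, symmetric])
      also have "z * (Q_block Q m (Suc k) k * U_star Q m k) = y * U_star Q m k"
        unfolding y_def by (rule assoc_mult_mat[OF z B Us, symmetric])
      finally show ?thesis .
    qed
    have "(\<Sum>l\<le>Suc k. (z * U_prod Q m (Suc k) l * Q_block Q m l j) $$ (0, c))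
        = (\<Sum>l\<le>k. (y * U_star Q m k * U_prod Q m k l * Q_block Q m l j) $$ (0, c))
          + (z * Q_block Q m (Suc k) j) $$ (0, c)"
      using step z by (simp add: U_prod_self del: U_prod.simps)
    also have "(\<Sum>l\<le>k. (y * U_star Q m k * U_prod Q m k l * Q_block Q m l j) $$ (0, c))
        = (if j = k then (y * U_star Q m k * level_schur Q m k) $$ (0, c) else 0)"
      using Suc.prems(1) Suc.prems(4) j yU by (intro Suc.IH) auto
    also have "y * U_star Q m k * level_schur Q m k = - y"
    proof -
      have "y * U_star Q m k * level_schur Q m k = y * (- 1\<^sub>m (m k))"
        using assoc_mult_mat[OF y Us level_schur_carrier[of Q m k]] inv by (simp add: U_star_inverts_def)
      then show ?thesis using y by simp
    qed
    \<comment> \<open>For \<open>j = k\<close> the remainder \<open>- y\<close> cancels the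
      subdiagonal term; for \<open>j < k\<close> the induction leaves nothing, and the block of
      \<open>Q\<close> is zero by the Hessenberg form.\<close>
    also have "(if j = k then (- y) $$ (0, c) else 0) + (z * Q_block Q m (Suc k) j) $$ (0, c) = 0"
    proof (cases "j = k")
      case True
      then have "(- y) $$ (0, c) = - (y $$ (0, c))"
        using y Suc.prems(4) by (intro index_uminus_mat(1)) auto
      with True show ?thesis by (simp add: y_def)
    next
      case False
      then have "Q_block Q m (Suc k) j = 0\<^sub>m (m (Suc k)) (m j)"
        using hess j by (simp add: upper_block_hessenberg_def)
      then show ?thesis using False z Suc.prems(4) by simp
    qed
    finally show ?thesis using \<open>j \<noteq> Suc k\<close> by simp
  qed
qed

definition level_row :: "(nat \<Rightarrow> nat \<Rightarrow> real) \<Rightarrow> (nat \<Rightarrow> nat) \<Rightarrow> nat \<Rightarrow> real mat \<Rightarrow> nat \<Rightarrow> real" where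
  "level_row Q m k z = block_entry m (\<lambda>l. z * U_prod Q m k l)"

text \<open>
  \<open>level_row Q m k z\<close> solves the left linear system of the truncation of \<open>Q\<close> to the levels \<open>0, \<dots>, k\<close>
  whose right-hand side lives on level \<open>k\<close> only.
\<close>

lemma level_row_equation:
  assumes hess: "upper_block_hessenberg Q m"
    and inv: "\<And>l. l < k \<Longrightarrow> U_star_inverts Q m l"
    and z: "z \<in> carrier_mat 1 (m k)" and jc: "j \<le> k" "c < m j"
  shows "(\<Sum>i<level_start m (Suc k). level_row Q m k z i * Q i (level_start m j + c))
       = (if j = k then (z * level_schur Q m k) $$ (0, c) else 0)"
proof -
  have "(\<Sum>i<level_start m (Suc k). level_row Q m k z i * Q i (level_start m j + c))
      = (\<Sum>l\<le>k. \<Sum>a<m l. (z * U_prod Q m k l) $$ (0, a) * Q_block Q m l j $$ (a, c))"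
    unfolding sum_lessThan_level_start level_row_def lessThan_Suc_atMost
    using jc by (intro sum.cong) (auto simp: block_entry_level Q_block_def)
  also have "\<dots> = (\<Sum>l\<le>k. (z * U_prod Q m k l * Q_block Q m l j) $$ (0, c))"
  proof (rule sum.cong)
    fix l assume "l \<in> {..k}"
    then have "z * U_prod Q m k l \<in> carrier_mat 1 (m l)"
      by (intro mult_carrier_mat[OF z] U_prod_carrier inv) auto
    from times_mat_entry[OF this Q_block_carrier[of Q m l j] _ jc(2), of 0]
    show "(\<Sum>a<m l. (z * U_prod Q m k l) $$ (0, a) * Q_block Q m l j $$ (a, c))
        = (z * U_prod Q m k l * Q_block Q m l j) $$ (0, c)" by simp
  qed simp
  also have "\<dots> = (if j = k then (z * level_schur Q m k) $$ (0, c) else 0)"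
    by (rule hessenberg_row_identity[OF hess inv z jc])
  finally show ?thesis .
qed

lemma level_row_top:
  assumes "z \<in> carrier_mat 1 (m k)" "a < m k"
  shows "level_row Q m k z (level_start m k + a) = z $$ (0, a)"
  using assms by (simp add: level_row_def block_entry_level U_prod_self)

text \<open>Strong induction on the level: a left kernel vector of the Schur complement extends
  through \<open>level_row\<close> to one of the whole truncation. The minimum principle applied to
  both signs makes it zero.\<close>

lemma U_star_inverts:
  assumes q: "q_matrix Q" and irr: "irreducible_q_matrix Q" and st: "stationary_distribution Q \<pi>"
    and hess: "upper_block_hessenberg Q m"
  shows "U_star_inverts Q m k"
proof (induction k rule: less_induct)
  case (less k)
  let ?S = "level_schur Q m k"
  have "mat_inv (- ?S) \<in> carrier_mat (m k) (m k) \<and> mat_inv (- ?S) * - ?S = 1\<^sub>m (m k)"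
  proof (rule mat_inv_if_row_injective)
    show "- ?S \<in> carrier_mat (m k) (m k)" by simp
    fix z assume z: "z \<in> carrier_mat 1 (m k)" and "z * - ?S = 0\<^sub>m 1 (m k)"
    then have neg: "- (z * ?S) = 0\<^sub>m 1 (m k)"
      using z by (subst (asm) uminus_mult_right_mat) (auto simp: carrier_matD[OF level_schur_carrier])
    have zS: "(z * ?S) $$ (0, c) = 0" if "c < m k" for c
    proof -
      have "(- (z * ?S)) $$ (0, c) = - ((z * ?S) $$ (0, c))"
        using z that by (intro index_uminus_mat) (auto simp: carrier_matD[OF level_schur_carrier])
      then show ?thesis unfolding neg using that by simp
    qed
    let ?A = "{..<level_start m (Suc k)}" and ?x = "level_row Q m k z"
    have eq: "(\<Sum>i\<in>?A. ?x i * Q i j) = 0" if "j \<in> ?A" for j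
    proof -
      from that obtain l c where "l < Suc k" "c < m l" "j = level_start m l + c"
        by (auto elim: level_decomposition)
      then show ?thesis using level_row_equation[OF hess less z, of l c] zS by auto
    qed
    have "?x i = 0" if "i \<in> ?A" for i
    proof (rule antisym)
      show "0 \<le> ?x i"
        by (rule finite_minimum_principle[OF q irr st _ _ that]) (auto simp: eq)
      have "0 \<le> - ?x i"
        by (rule finite_minimum_principle[OF q irr st _ _ that]) (auto simp: sum_negf eq)
      then show "?x i \<le> 0" by simp
    qed
    then have "z $$ (0, a) = 0" if "a < m k" for a
      using level_row_top[of z m k a Q, OF z that] that by (simp add: level_start_Suc)
    then show "z = 0\<^sub>m 1 (m k)" using z by (intro eq_matI) auto
  qed
  then have M: "U_star Q m k \<in> carrier_mat (m k) (m k)" and "U_star Q m k * - ?S = 1\<^sub>m (m k)"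
    by (auto simp: U_star_eq)
  then have "- (U_star Q m k * ?S) = 1\<^sub>m (m k)"
    by (subst (asm) uminus_mult_right_mat)
      (auto simp: carrier_matD[OF M] carrier_matD[OF level_schur_carrier])
  then have "U_star Q m k * ?S = - 1\<^sub>m (m k)"
    by (metis uminus_uminus_mat)
  with M show ?case by (simp add: U_star_inverts_def)
qed

subsection \<open>Convergence\<close>

text \<open>Nonnegativity is the minimum principle. For strictness, a zero inside the truncation
  would spread to all predecessors and make the finite truncation the whole state space.\<close>

lemma level_row_pos:
  assumes q: "q_matrix Q" and irr: "irreducible_q_matrix Q" and st: "stationary_distribution Q \<pi>"
    and m: "\<forall>k. 0 < m k" and hess: "upper_block_hessenberg Q m"
    and i: "i < level_start m (Suc s)"
  shows "0 < level_row Q m s (ones_row (m s) * U_star Q m s) i"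
    and "(\<Sum>k<level_start m (Suc s). level_row Q m s (ones_row (m s) * U_star Q m s) k * Q k i) \<le> 0"
proof -
  note inv = U_star_inverts[OF q irr st hess]
  let ?z = "ones_row (m s) * U_star Q m s" and ?A = "{..<level_start m (Suc s)}"
  let ?x = "level_row Q m s ?z"
  have U: "U_star Q m s \<in> carrier_mat (m s) (m s)" using inv by (simp add: U_star_inverts_def)
  have ones: "ones_row (m s) \<in> carrier_mat 1 (m s)" by (simp add: ones_row_def)
  have z: "?z \<in> carrier_mat 1 (m s)" by (rule mult_carrier_mat[OF ones U])
  have "?z * level_schur Q m s = ones_row (m s) * (- 1\<^sub>m (m s))"
    using assoc_mult_mat[OF ones U level_schur_carrier[of Q m s]] inv by (simp add: U_star_inverts_def)
  also have "\<dots> = - ones_row (m s)"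
    using ones by simp
  finally have zS: "?z * level_schur Q m s = - ones_row (m s)" .
  \<comment> \<open>The right-hand side is \<open>- 1\<close> on the top level and zero below it, as
    \<open>U_star\<close> inverts the negative Schur complement.\<close>
  have eq: "(\<Sum>i\<in>?A. ?x i * Q i j) = (if j < level_start m s then 0 else - 1)" if "j \<in> ?A" for j
  proof -
    from that obtain l c where l: "l < Suc s" "c < m l" "j = level_start m l + c"
      by (auto elim: level_decomposition)
    then have "l \<noteq> s \<Longrightarrow> j < level_start m s"
      using level_start_mono[of "Suc l" s m] by (auto simp: level_start_Suc)
    then have "l = s \<longleftrightarrow> \<not> j < level_start m s"
      using l by auto
    moreover have "(?z * level_schur Q m s) $$ (0, c) = - 1" if "c < m s"
      unfolding zS using that by (simp add: ones_row_def)
    ultimately show ?thesis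
      using level_row_equation[OF hess inv z, of l c] l by auto
  qed
  have le: "(\<Sum>i\<in>?A. ?x i * Q i j) \<le> 0" if "j \<in> ?A" for j
    using eq[OF that] by simp
  then show "(\<Sum>k\<in>?A. ?x k * Q k i) \<le> 0"
    using i by simp
  have nn: "0 \<le> ?x i" if "i \<in> ?A" for i
    by (rule finite_minimum_principle[OF q irr st _ le that]) auto
  have "?x i \<noteq> 0"
  proof
    assume "?x i = 0"
    have "{i \<in> ?A. ?x i = 0} = UNIV"
    proof (rule irreducible_predecessor_closed[OF irr])
      show "i \<in> {i \<in> ?A. ?x i = 0}" using i \<open>?x i = 0\<close> by simp
    next
      fix i j assume j: "j \<in> {i \<in> ?A. ?x i = 0}" and ij: "i \<noteq> j" "0 < Q i j"
      have t: "0 \<le> ?x k * Q k j" if "k \<in> ?A" for k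
        using j nn[OF that] q_matrix_offdiag_nonneg[OF q, of k j] by (cases "k = j") auto
      \<comment> \<open>A nonnegative column sum excludes the value \<open>- 1\<close>, so a zero
        \<open>j\<close> lies strictly below level \<open>s\<close>.\<close>
      then have "0 \<le> (\<Sum>k\<in>?A. ?x k * Q k j)" by (intro sum_nonneg)
      with eq[of j] j have j_lt: "j < level_start m s" and "(\<Sum>k\<in>?A. ?x k * Q k j) = 0"
        by (auto split: if_splits)
      then have zero: "?x k * Q k j = 0" if "k \<in> ?A" for k
        using sum_nonneg_eq_0_iff[of ?A "\<lambda>k. ?x k * Q k j"] t that by simp
      \<comment> \<open>A jump goes down by at most one level, so no state above level
        \<open>s\<close> can reach \<open>j\<close>, which lies below level \<open>s\<close>, in one
        jump.\<close>
      have "i \<in> ?A"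
      proof (rule ccontr)
        assume "i \<notin> ?A"
        obtain l c where l: "l < s" "c < m l" "j = level_start m l + c"
          using j_lt by (auto elim: level_decomposition)
        have "i < level_start m (Suc i)" using le_level_start[OF m, of "Suc i"] by simp
        then obtain k a where k: "a < m k" "i = level_start m k + a"
          by (auto elim: level_decomposition)
        have "Suc s \<le> k"
        proof (rule ccontr)
          assume "\<not> Suc s \<le> k"
          then have "level_start m (Suc k) \<le> level_start m (Suc s)" by (intro level_start_mono) simp
          with k \<open>i \<notin> ?A\<close> show False by (simp add: level_start_Suc)
        qed
        with l k have "Q i j = 0" using upper_block_hessenberg_entry[OF hess, of l k a c] by simp
        with ij show False by simp
      qed
      with zero[OF this] ij show "i \<in> {i \<in> ?A. ?x i = 0}" by simp
    qed
    then have "finite (UNIV :: nat set)" 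
      by (rule subst) simp
    then show False by simp
  qed
  with nn i show "0 < ?x i" by (simp add: less_le)
qed

text \<open>Associativity moves the row of ones to the left in numerator and denominator, so that
  both are read off the same vector \<open>X\<close>, whose ratio limits are known.\<close>

lemma eta_block_entry:
  assumes inv: "\<And>k. U_star_inverts Q m k" and k: "k \<le> N" "N \<le> s" "a < m k"
  defines "X \<equiv> level_row Q m s (ones_row (m s) * U_star Q m s)"
  shows "eta_block Q m N s k $$ (0, a)
       = X (level_start m k + a) / (\<Sum>i<level_start m (Suc N). X i)"
proof -
  let ?z = "ones_row (m s) * U_star Q m s"
  have Us: "U_star Q m s \<in> carrier_mat (m s) (m s)" using inv by (simp add: U_star_inverts_def)
  have ones: "ones_row (m s) \<in> carrier_mat 1 (m s)" by (simp add: ones_row_def)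
  have z: "?z \<in> carrier_mat 1 (m s)" by (rule mult_carrier_mat[OF ones Us])
  have U: "U_prod Q m s l \<in> carrier_mat (m s) (m l)" if "l \<le> N" for l
    using that k by (intro U_prod_carrier inv) auto
  have zU: "?z * U_prod Q m s l \<in> carrier_mat 1 (m l)" if "l \<le> N" for l
    by (rule mult_carrier_mat[OF z U[OF that]])
  have UU: "U_star Q m s * U_prod Q m s l \<in> carrier_mat (m s) (m l)" if "l \<le> N" for l
    by (rule mult_carrier_mat[OF Us U[OF that]])
  have oc: "ones_col n \<in> carrier_mat n 1" for n by (simp add: ones_col_def)
  have X: "X (level_start m l + a) = (?z * U_prod Q m s l) $$ (0, a)" if "a < m l" for l a
    using that by (simp add: X_def level_row_def block_entry_level)
  have assoc: "ones_row (m s) * (U_star Q m s * U_prod Q m s l) = ?z * U_prod Q m s l" if "l \<le> N" for l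
    by (rule assoc_mult_mat[OF ones Us U[OF that], symmetric])
  have "(ones_row (m s) * mat_sum (m s) 1 (\<lambda>l. U_star Q m s * U_prod Q m s l * ones_col (m l)) {..N}) $$ (0, 0)
      = (\<Sum>l\<le>N. (ones_row (m s) * (U_star Q m s * U_prod Q m s l * ones_col (m l))) $$ (0, 0))"
  proof (rule times_mat_sum_entry[OF ones])
    fix l assume "l \<in> {..N}"
    then show "U_star Q m s * U_prod Q m s l * ones_col (m l) \<in> carrier_mat (m s) 1"
      by (intro mult_carrier_mat[OF UU oc]) simp
  qed simp_all
  also have "\<dots> = (\<Sum>l\<le>N. \<Sum>a<m l. X (level_start m l + a))"
  proof (rule sum.cong)
    fix l assume "l \<in> {..N}"
    then have l: "l \<le> N" by simp
    have "ones_row (m s) * (U_star Q m s * U_prod Q m s l * ones_col (m l))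
        = ?z * U_prod Q m s l * ones_col (m l)"
      using assoc_mult_mat[OF ones UU[OF l] oc] assoc[OF l] by simp
    then show "(ones_row (m s) * (U_star Q m s * U_prod Q m s l * ones_col (m l))) $$ (0, 0)
        = (\<Sum>a<m l. X (level_start m l + a))"
      using times_mat_entry[OF zU[OF l] oc, of 0 0] X by (simp add: ones_col_def)
  qed simp
  also have "\<dots> = (\<Sum>i<level_start m (Suc N). X i)"
    by (simp only: sum_lessThan_level_start lessThan_Suc_atMost)
  moreover have "(r \<cdot>\<^sub>m (?z * U_prod Q m s k)) $$ (0, a) = r * (?z * U_prod Q m s k) $$ (0, a)" for r
    using zU[OF k(1)] k(3) by (intro index_smult_mat(1)) auto
  ultimately show ?thesis
    unfolding eta_block_def using k X[of a k] by (simp add: assoc del: index_mult_mat index_smult_mat)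
qed

lemma pi_trunc_block_entry:
  assumes "a < m k"
  shows "pi_trunc_block \<pi> m N k $$ (0, a)
       = \<pi> (level_start m k + a) / (\<Sum>i<level_start m (Suc N). \<pi> i)"
proof -
  have "(pi_block \<pi> m l * ones_col (m l)) $$ (0, 0) = (\<Sum>a<m l. \<pi> (level_start m l + a))" for l
    by (subst times_mat_entry[of _ 1 "m l" _ 1]) (auto simp: pi_block_def ones_col_def)
  then have "(\<Sum>l\<le>N. (pi_block \<pi> m l * ones_col (m l)) $$ (0, 0)) = (\<Sum>i<level_start m (Suc N). \<pi> i)"
    by (simp only: sum_lessThan_level_start lessThan_Suc_atMost)
  then show ?thesis using assms by (simp add: pi_trunc_block_def pi_block_def)
qed

lemma eta_block_tendsto:
  assumes erg: "generator_of_ergodic_chain Q P Y S" and st: "stationary_distribution Q \<pi>"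
    and m: "\<forall>k. 0 < m k" and hess: "upper_block_hessenberg Q m"
    and k: "k \<le> N" "a < m k"
  shows "(\<lambda>s. eta_block Q m N s k $$ (0, a)) \<longlonglongrightarrow> pi_trunc_block \<pi> m N k $$ (0, a)"
proof -
  have mc: "markov_chain_with_generator Q P Y S" and irr: "irreducible_q_matrix Q"
    and pr: "positive_recurrent P Y S" and q: "q_matrix Q"
    using erg by (auto simp: generator_of_ergodic_chain_def markov_chain_with_generator_def)
  have p: "0 < \<pi> i" for i using st by (auto simp: stationary_distribution_def)
  define X where "X s = level_row Q m s (ones_row (m s) * U_star Q m s)" for s
  define n where "n s = level_start m (Suc s)" for s
  have n_gt: "s < n s" for s using le_level_start[OF m, of "Suc s"] by (simp add: n_def)
  then have n: "filterlim n at_top sequentially"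
    by (intro filterlim_at_top_mono[OF filterlim_ident]) (auto simp: less_imp_le)
  have pos: "0 < X s i" if "i < n s" for s i
    using level_row_pos(1)[OF q irr st m hess] that by (simp add: X_def n_def)
  have sub: "eventually (\<lambda>s. (\<Sum>i<n s. X s i * Q i j) \<le> 0) sequentially" for j
    using eventually_ge_at_top[of j]
  proof eventually_elim
    case (elim s)
    then have "j < level_start m (Suc s)" using n_gt[of s] by (simp add: n_def)
    from level_row_pos(2)[OF q irr st m hess this] show ?case by (simp add: X_def n_def)
  qed
  have lim: "(\<lambda>s. X s j / X s 0) \<longlonglongrightarrow> \<pi> j / \<pi> 0" for j
    using subinvariant_ratio_tendsto[OF q irr st excursion_measure_self[OF mc pr] n _ sub] pos
    by blast
  let ?i = "level_start m k + a" and ?n = "level_start m (Suc N)"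
  have "0 < ?n" using le_level_start[OF m, of "Suc N"] by simp
  then have psum: "0 < (\<Sum>i<?n. \<pi> i)" using p by (intro sum_pos) auto
  \<comment> \<open>Dividing numerator and denominator by \<open>X s 0\<close> leaves only finitely
    many ratios with a known limit.\<close>
  have "(\<lambda>s. X s ?i / X s 0 / (\<Sum>i<?n. X s i / X s 0)) \<longlonglongrightarrow> \<pi> ?i / \<pi> 0 / (\<Sum>i<?n. \<pi> i / \<pi> 0)"
    using psum p[of 0] by (intro tendsto_divide tendsto_sum lim) (auto simp: sum_divide_distrib[symmetric])
  also have "\<pi> ?i / \<pi> 0 / (\<Sum>i<?n. \<pi> i / \<pi> 0) = pi_trunc_block \<pi> m N k $$ (0, a)"
    using p[of 0] k by (simp add: pi_trunc_block_entry sum_divide_distrib[symmetric])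
  finally show ?thesis
  proof (rule Lim_transform_eventually)
    \<comment> \<open>The condition \<open>N \<le> s\<close> keeps \<open>U_prod Q m s l\<close>
      within the range \<open>l \<le> s\<close> where it is meaningful.\<close>
    show "eventually (\<lambda>s. X s ?i / X s 0 / (\<Sum>i<?n. X s i / X s 0) = eta_block Q m N s k $$ (0, a)) sequentially"
      using eventually_ge_at_top[of N]
    proof eventually_elim
      case (elim s)
      have "0 < X s 0" using n_gt[of s] by (intro pos) simp
      then show ?case
        using eta_block_entry[OF U_star_inverts[OF q irr st hess] k(1) elim k(2)]
        by (simp add: sum_divide_distrib[symmetric] X_def)
    qed
  qed
qed

theorem corollary3p2:
  fixes Q :: "nat \<Rightarrow> nat \<Rightarrow> real"
    and P :: "nat \<Rightarrow> 'w measure"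
    and Y :: "nat \<Rightarrow> 'w \<Rightarrow> nat"
    and S :: "nat \<Rightarrow> 'w \<Rightarrow> real"
    and \<pi> :: "nat \<Rightarrow> real"
    and m :: "nat \<Rightarrow> nat"
  assumes "generator_of_ergodic_chain Q P Y S"
    and "stationary_distribution Q \<pi>"
    and "\<forall>k. 0 < m k"
    and "upper_block_hessenberg Q m"
  shows "(\<forall>N\<ge>1. (\<lambda>s. block_row_norm N (\<lambda>k. eta_block Q m N s k - pi_trunc_block \<pi> m N k))
                    \<longlonglongrightarrow> 0) \<and>
         (\<forall>k. \<forall>j < m k.
            (\<forall>N. 1 \<le> N \<and> k \<le> N \<longrightarrow> convergent (\<lambda>s. eta_block Q m N s k $$ (0, j))) \<and>
            (\<lambda>N. lim (\<lambda>s. eta_block Q m N s k $$ (0, j))) \<longlonglongrightarrow> pi_block \<pi> m k $$ (0, j))"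
proof (intro conjI allI impI)
  fix N :: nat
  have dim: "dim_col (pi_trunc_block \<pi> m N k) = m k" "dim_row (pi_trunc_block \<pi> m N k) = 1" for k
    by (simp_all add: pi_trunc_block_def pi_block_def)
  \<comment> \<open>For fixed \<open>N\<close> the norm is a finite sum, so entrywise convergence is
    enough.\<close>
  have "(\<lambda>s. \<Sum>k\<le>N. \<Sum>j<m k. \<bar>eta_block Q m N s k $$ (0, j) - pi_trunc_block \<pi> m N k $$ (0, j)\<bar>)
      \<longlonglongrightarrow> (\<Sum>k\<le>N. \<Sum>j<m k. \<bar>pi_trunc_block \<pi> m N k $$ (0, j) - pi_trunc_block \<pi> m N k $$ (0, j)\<bar>)"
    by (intro tendsto_sum tendsto_rabs tendsto_diff tendsto_const eta_block_tendsto[OF assms]) auto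
  then show "(\<lambda>s. block_row_norm N (\<lambda>k. eta_block Q m N s k - pi_trunc_block \<pi> m N k)) \<longlonglongrightarrow> 0"
    by (simp add: block_row_norm_def row_norm_def dim)
next
  fix k j N assume "j < m k" "1 \<le> N \<and> k \<le> N"
  then show "convergent (\<lambda>s. eta_block Q m N s k $$ (0, j))"
    using eta_block_tendsto[OF assms] by (auto simp: convergent_def)
next
  fix k j assume j: "j < m k"
  let ?i = "level_start m k + j"
  have "\<pi> sums 1" using assms(2) by (simp add: stationary_distribution_def)
  then have "(\<lambda>n. \<Sum>i<n. \<pi> i) \<longlonglongrightarrow> 1" by (simp add: sums_def)
  \<comment> \<open>As levels are nonempty, the masses of the levels up to \<open>N\<close> run
    along partial sums of \<open>\<pi>\<close> with unbounded index, hence tend to 1.\<close>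
  moreover have "filterlim (\<lambda>N. level_start m (Suc N)) at_top sequentially"
    using le_level_start[OF assms(3)]
    by (intro filterlim_at_top_mono[OF filterlim_ident] always_eventually) (auto intro: Suc_leD)
  ultimately have "(\<lambda>N. \<Sum>i<level_start m (Suc N). \<pi> i) \<longlonglongrightarrow> 1"
    by (rule filterlim_compose)
  then have "(\<lambda>N. \<pi> ?i / (\<Sum>i<level_start m (Suc N). \<pi> i)) \<longlonglongrightarrow> \<pi> ?i / 1"
    by (intro tendsto_divide tendsto_const) auto
  also have "\<pi> ?i / 1 = pi_block \<pi> m k $$ (0, j)"
    using j by (simp add: pi_block_def)
  finally have lim: "(\<lambda>N. \<pi> ?i / (\<Sum>i<level_start m (Suc N). \<pi> i)) \<longlonglongrightarrow> pi_block \<pi> m k $$ (0, j)" .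
  \<comment> \<open>Once \<open>N \<ge> k\<close>, the inner limit is the entry of the truncated and
    renormalised stationary vector.\<close>
  have "eventually (\<lambda>N. \<pi> ?i / (\<Sum>i<level_start m (Suc N). \<pi> i)
      = lim (\<lambda>s. eta_block Q m N s k $$ (0, j))) sequentially"
    using eventually_ge_at_top[of k]
  proof eventually_elim
    case (elim N)
    from limI[OF eta_block_tendsto[OF assms elim j]] show ?case
      using j by (simp add: pi_trunc_block_entry)
  qed
  with lim show "(\<lambda>N. lim (\<lambda>s. eta_block Q m N s k $$ (0, j))) \<longlonglongrightarrow> pi_block \<pi> m k $$ (0, j)"
    by (rule Lim_transform_eventually)
qed

end
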